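(* Let $n\in\mathbb{N}$, let $A$ be a semisimple commutative unital Banach algebra with connected Gelfand space $\Delta(A)$, and let $f\in\mathrm{GFS}(\mathbb{R}^n,A)$. Then the following are equivalent: (i) $f$ is invertible in $\mathrm{GFS}(\mathbb{R}^n,A)$. (vii) $f(0)\in A^{-1}$ and there exist some $\gamma\in\mathbb{R}^n$ and $g_1\in\mathrm{GFS}(\mathbb{R}^n,A)$ such that $f(z)=f(0)\exp(i\gamma^Tz\,e_A+g_1(z))$ for all $z\in\mathbb{R}^n$. (viii) $f(0)\in A^{-1}$ and there exist some $\gamma\in\mathbb{R}^n$ and $g_2\in\mathrm{GFS}(\mathbb{R}^n,A)$ such that $f(z)=f(0)\exp(i\gamma^Tz\,e_A+g_2(z)-g_2(0))$ for all $z\in\mathbb{R}^n$.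
   Context: All Banach algebras are complex; a commutative Banach algebra $A$ is unital if it has an identity $e_A$ with $\|e_A\|_A=1$. $A^{-1}$ is the set of invertible elements of $A$, and $\exp(a)=\sum_{j=0}^\infty a^j/j!$ with $a^0=e_A$. The Gelfand space $\Delta(A)$ is the set of all non-zero multiplicative linear maps $\varphi:A\to\mathbb{C}$, equipped with the weak-$\ast$ topology (the weakest topology making $\varphi\mapsto\varphi(a)$ continuous for every $a\in A$). $A$ is semisimple if for every $a\in A\setminus\{0\}$ there is $\varphi\in\Delta(A)$ with $\varphi(a)\neq0$. $\mathrm{GFS}(\mathbb{R}^n,A)$ (generalised Fourier series) is the set of all functions $\mathbb{R}^n\to A$ of the form $z\mapsto\sum_{x\in B}e^{ix^Tz}a_x$ for some countable set $B\subset\mathbb{R}^n$ and some absolutely summable family $(a_x)_{x\in B}$ in $A$. With pointwise operations and norm $\|\sum_{x\in B}e^{ix^T\cdot}a_x\|=\sum_{x\in B}\|a_x\|_A$ (well defined, as the coefficients are uniquely determined by the function) it is a commutative unital Banach algebra whose identity is the constant function $e_A$. *)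

theory Defs
  imports "HOL-Analysis.Analysis"
begin

text \<open>Commutative unital complex Banach algebras. The class real_normed_algebra_1 contributes
  \<open>norm (x * y) \<le> norm x * norm y\<close> and \<open>norm 1 = 1\<close>; complex scalar multiplication extends the
  real one, so \<open>scaleC 1 x = x\<close> follows from \<open>scaleC_of_real\<close>.\<close>

class comm_complex_banach_algebra_1 = banach + real_normed_algebra_1 + comm_ring_1 +
  fixes scaleC :: "complex \<Rightarrow> 'a \<Rightarrow> 'a"
  assumes scaleC_add_right: "scaleC c (x + y) = scaleC c x + scaleC c y"
    and scaleC_add_left: "scaleC (c + d) x = scaleC c x + scaleC d x"
    and scaleC_scaleC: "scaleC c (scaleC d x) = scaleC (c * d) x"
    and scaleC_of_real: "scaleC (complex_of_real r) x = r *\<^sub>R x"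
    and mult_scaleC_left: "scaleC c x * y = scaleC c (x * y)"
    and norm_scaleC: "norm (scaleC c x) = cmod c * norm x"

instantiation complex :: comm_complex_banach_algebra_1
begin

definition scaleC_complex :: "complex \<Rightarrow> complex \<Rightarrow> complex"
  where "scaleC_complex c x = c * x"

instance
  by standard (simp_all add: scaleC_complex_def algebra_simps norm_mult scaleR_conv_of_real)

end

definition gelfand_space :: "('a::comm_complex_banach_algebra_1 \<Rightarrow> complex) set"
  where "gelfand_space = {\<phi>.
    (\<exists>a. \<phi> a \<noteq> 0) \<and>
    (\<forall>a b. \<phi> (a + b) = \<phi> a + \<phi> b) \<and>
    (\<forall>c a. \<phi> (scaleC c a) = c * \<phi> a) \<and>
    (\<forall>a b. \<phi> (a * b) = \<phi> a * \<phi> b)}"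

text \<open>The weak-* topology, i.e. the weakest topology on the Gelfand space making all
  evaluations \<open>\<phi> \<mapsto> \<phi> a\<close> continuous.\<close>

definition gelfand_topology :: "('a::comm_complex_banach_algebra_1 \<Rightarrow> complex) topology"
  where "gelfand_topology =
    topology_generated_by {{\<phi> \<in> gelfand_space. \<phi> a \<in> U} | a U. open U}"

definition semisimple :: "'a::comm_complex_banach_algebra_1 itself \<Rightarrow> bool"
  where "semisimple _ \<longleftrightarrow> (\<forall>a::'a. a \<noteq> 0 \<longrightarrow> (\<exists>\<phi>\<in>gelfand_space. \<phi> a \<noteq> 0))"

text \<open>Only the values of \<open>a\<close> on \<open>B\<close> matter. Absolute summability makes the unconditional
  sum exist for every \<open>z\<close>, so the default value of infsum never intervenes.\<close>

definition GFS :: "(real ^ 'n \<Rightarrow> 'a::comm_complex_banach_algebra_1) set"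
  where "GFS = {f. \<exists>B a. countable B \<and> (\<lambda>x. norm (a x)) summable_on B \<and>
    (\<forall>z. f z = (\<Sum>\<^sub>\<infinity>x\<in>B. scaleC (exp (\<i> * complex_of_real (x \<bullet> z))) (a x)))}"

text \<open>Products in GFS are pointwise and the identity is the constant function 1.\<close>

definition GFS_invertible :: "(real ^ 'n \<Rightarrow> 'a::comm_complex_banach_algebra_1) \<Rightarrow> bool"
  where "GFS_invertible f \<longleftrightarrow> f \<in> GFS \<and> (\<exists>h\<in>GFS. (\<lambda>z. f z * h z) = (\<lambda>z. 1))"

end

theory Submission imports Defs begin

text \<open>
  Coefficients of a generalised Fourier series are determined by its values, so GFS is an \<open>l\<^sup>1\<close>
  convolution algebra over the group \<open>\<real>\<^sup>n\<close>, and the point is that every unit \<open>a\<close> in it is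
  \<open>c e\<^sup>i\<^sup>\<gamma>\<^sup>z exp g\<close>. Up to an exponential factor a unit has finite support, hence lies
  in \<open>l\<^sup>1(G)\<close> for a finitely generated \<open>G\<close>, and one argues by adding generators to \<open>G\<close>. A new generator
  \<open>y\<close> independent of \<open>G\<close> gives an integer grading of \<open>l\<^sup>1(G + \<int>y)\<close> and a derivation \<open>D\<close>. As the
  degrees are integers, there are no small divisors: the logarithmic derivative \<open>D a / a\<close> can be integrated
  inside the algebra up to its part \<open>\<kappa>\<close> of degree 0. Characters take integer values on \<open>\<kappa>\<close>, so by
  semisimplicity and connectedness \<open>\<kappa>\<close> is an integer \<open>N\<close>, and \<open>a\<close> is \<open>e\<^sup>i\<^sup>N\<^sup>y\<^sup>z\<close> times an exponential
  times a unit of \<open>l\<^sup>1(G)\<close>. A generator dependent on \<open>G\<close> is absorbed by rescaling \<open>G\<close>.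
\<close>

section \<open>The convolution algebra of absolutely summable families\<close>

text \<open>All families live on the whole index type, so sums and products involve no bookkeeping
  of index sets. Absolute summability already forces the support to be countable.\<close>

typedef (overloaded) ('e, 'a) fourier =
  "{a :: 'e \<Rightarrow> 'a::real_normed_vector. (\<lambda>x. norm (a x)) summable_on UNIV}"
  morphisms coeff Fourier
proof
  show "(\<lambda>_. 0) \<in> {a :: 'e \<Rightarrow> 'a. (\<lambda>x. norm (a x)) summable_on UNIV}"
    by simp
qed

setup_lifting type_definition_fourier

lemma norm_coeff_summable: "(\<lambda>x. norm (coeff a x)) summable_on A"
  using coeff[of a] summable_on_subset_banach[of _ UNIV A] by auto

lemma fourier_eqI: "(\<And>x. coeff a x = coeff b x) \<Longrightarrow> a = b"
  by (metis coeff_inject ext)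

instantiation fourier :: (type, real_normed_vector) real_normed_vector
begin

lift_definition zero_fourier :: "('a, 'b) fourier" is "\<lambda>_. 0"
  by simp

lift_definition plus_fourier :: "('a, 'b) fourier \<Rightarrow> ('a, 'b) fourier \<Rightarrow> ('a, 'b) fourier"
  is "\<lambda>a b x. a x + b x"
proof -
  fix a b :: "'a \<Rightarrow> 'b"
  assume "(\<lambda>x. norm (a x)) summable_on UNIV" "(\<lambda>x. norm (b x)) summable_on UNIV"
  then have "(\<lambda>x. norm (a x) + norm (b x)) summable_on UNIV"
    by (rule summable_on_add)
  then show "(\<lambda>x. norm (a x + b x)) summable_on UNIV"
    by (rule Infinite_Sum.abs_summable_on_comparison_test') (rule norm_triangle_ineq)
qed

lift_definition uminus_fourier :: "('a, 'b) fourier \<Rightarrow> ('a, 'b) fourier"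
  is "\<lambda>a x. - a x"
  by simp

lift_definition scaleR_fourier :: "real \<Rightarrow> ('a, 'b) fourier \<Rightarrow> ('a, 'b) fourier"
  is "\<lambda>r a x. r *\<^sub>R a x"
  by (auto intro: summable_on_cmult_right)

definition minus_fourier :: "('a, 'b) fourier \<Rightarrow> ('a, 'b) fourier \<Rightarrow> ('a, 'b) fourier"
  where "minus_fourier a b = a + - b"

definition norm_fourier :: "('a, 'b) fourier \<Rightarrow> real"
  where "norm_fourier a = (\<Sum>\<^sub>\<infinity>x. norm (coeff a x))"

definition sgn_fourier :: "('a, 'b) fourier \<Rightarrow> ('a, 'b) fourier"
  where "sgn_fourier a = inverse (norm a) *\<^sub>R a"

definition dist_fourier :: "('a, 'b) fourier \<Rightarrow> ('a, 'b) fourier \<Rightarrow> real"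
  where "dist_fourier a b = norm (a - b)"

definition uniformity_fourier :: "(('a, 'b) fourier \<times> ('a, 'b) fourier) filter"
  where "uniformity_fourier = (INF e\<in>{0 <..}. principal {(x, y). dist x y < e})"

definition open_fourier :: "('a, 'b) fourier set \<Rightarrow> bool"
  where "open_fourier U \<longleftrightarrow> (\<forall>x\<in>U. \<forall>\<^sub>F (x', y) in uniformity. x' = x \<longrightarrow> y \<in> U)"

instance
proof
  fix a b c :: "('a, 'b) fourier" and r s :: real
  show "a + b + c = a + (b + c)" "a + b = b + a" "0 + a = a" "- a + a = 0"
    "r *\<^sub>R (a + b) = r *\<^sub>R a + r *\<^sub>R b" "(r + s) *\<^sub>R a = r *\<^sub>R a + s *\<^sub>R a"
    "r *\<^sub>R s *\<^sub>R a = (r * s) *\<^sub>R a" "1 *\<^sub>R a = a"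
    by (transfer; simp add: algebra_simps)+
  show "a - b = a + - b"
    by (rule minus_fourier_def)
  show "dist a b = norm (a - b)" "sgn a = inverse (norm a) *\<^sub>R a"
    "(uniformity :: (('a, 'b) fourier \<times> ('a, 'b) fourier) filter)
      = (INF e\<in>{0 <..}. principal {(x, y). dist x y < e})"
    by (simp_all add: dist_fourier_def sgn_fourier_def uniformity_fourier_def)
  show "open U \<longleftrightarrow> (\<forall>x\<in>U. \<forall>\<^sub>F (x', y) in uniformity. x' = x \<longrightarrow> y \<in> U)"
    for U :: "('a, 'b) fourier set"
    by (rule open_fourier_def)
  show "norm a = 0 \<longleftrightarrow> a = 0"
  proof
    assume "norm a = 0"
    then have "norm (coeff a x) = 0" for x
      using nonneg_infsum_le_0D[of "\<lambda>x. norm (coeff a x)" UNIV x] norm_coeff_summable[of a UNIV]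
      by (simp add: norm_fourier_def)
    then show "a = 0"
      by (intro fourier_eqI) (simp add: zero_fourier.rep_eq)
  qed (simp add: norm_fourier_def zero_fourier.rep_eq)
  have "(\<Sum>\<^sub>\<infinity>x. norm (coeff a x + coeff b x)) \<le> (\<Sum>\<^sub>\<infinity>x. norm (coeff a x) + norm (coeff b x))"
    using norm_coeff_summable[of "a + b" UNIV]
    by (intro infsum_mono summable_on_add norm_coeff_summable norm_triangle_ineq)
      (simp add: plus_fourier.rep_eq)
  then show "norm (a + b) \<le> norm a + norm b"
    by (simp add: norm_fourier_def plus_fourier.rep_eq infsum_add norm_coeff_summable)
  show "norm (r *\<^sub>R a) = \<bar>r\<bar> * norm a"
    by (simp add: norm_fourier_def scaleR_fourier.rep_eq infsum_cmult_right')
qed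

end

lemma coeff_diff: "coeff (a - b) x = coeff a x - coeff b x"
  unfolding minus_fourier_def plus_fourier.rep_eq uminus_fourier.rep_eq by simp

lemmas coeff_simps = zero_fourier.rep_eq plus_fourier.rep_eq uminus_fourier.rep_eq
  scaleR_fourier.rep_eq coeff_diff

lemma sum_norm_coeff_le: "finite F \<Longrightarrow> (\<Sum>x\<in>F. norm (coeff a x)) \<le> norm a"
  unfolding norm_fourier_def by (rule finite_sum_le_infsum) (auto simp: norm_coeff_summable)

lemma norm_coeff_le: "norm (coeff a x) \<le> norm a"
  using sum_norm_coeff_le[of "{x}" a] by simp

lemma norm_fourier_le:
  assumes "\<And>F. finite F \<Longrightarrow> (\<Sum>x\<in>F. norm (coeff a x)) \<le> C"
  shows "norm a \<le> C"
  unfolding norm_fourier_def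
  by (rule infsum_le_finite_sums) (auto simp: norm_coeff_summable assms)

lemma bounded_linear_coeff: "bounded_linear (\<lambda>a. coeff a x)"
  by (rule bounded_linear_intro[of _ 1]) (simp_all add: coeff_simps norm_coeff_le)

instance fourier :: (type, banach) banach
proof
  fix X :: "nat \<Rightarrow> ('a, 'b) fourier"
  assume X: "Cauchy X"
  \<comment> \<open>The limit is built coefficientwise. Norm bounds pass to the limit on finite
    index sets first and are then extended to all indices.\<close>
  define l where "l x = lim (\<lambda>n. coeff (X n) x)" for x
  have l: "(\<lambda>n. coeff (X n) x) \<longlonglongrightarrow> l x" for x
    unfolding l_def using bounded_linear.Cauchy[OF bounded_linear_coeff X]
    by (metis Cauchy_convergent_iff convergent_LIMSEQ_iff)
  obtain C where C: "\<And>n. norm (X n) \<le> C"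
    using Cauchy_Bseq[OF X] by (auto simp: Bseq_def)
  have "(\<Sum>x\<in>F. norm (l x)) \<le> C" if "finite F" for F
  proof (rule LIMSEQ_le_const2)
    show "(\<lambda>n. \<Sum>x\<in>F. norm (coeff (X n) x)) \<longlonglongrightarrow> (\<Sum>x\<in>F. norm (l x))"
      by (intro tendsto_intros l)
    show "\<exists>N. \<forall>n\<ge>N. (\<Sum>x\<in>F. norm (coeff (X n) x)) \<le> C"
      by (intro exI[of _ 0] allI impI order_trans[OF sum_norm_coeff_le[OF that] C])
  qed
  then have "(\<lambda>x. norm (l x)) summable_on UNIV"
    by (intro nonneg_bdd_above_summable_on bdd_aboveI2[of _ _ C]) auto
  then have cl: "coeff (Fourier l) x = l x" for x
    by (simp add: Fourier_inverse)
  have "X \<longlonglongrightarrow> Fourier l"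
  proof (rule metric_LIMSEQ_I)
    fix e :: real
    assume "0 < e"
    then obtain M where M: "\<And>m n. m \<ge> M \<Longrightarrow> n \<ge> M \<Longrightarrow> dist (X m) (X n) < e / 2"
      using metric_CauchyD[OF X, of "e / 2"] by auto
    have "norm (X n - Fourier l) \<le> e / 2" if n: "n \<ge> M" for n
    proof (rule norm_fourier_le)
      fix F :: "'a set"
      assume F: "finite F"
      show "(\<Sum>x\<in>F. norm (coeff (X n - Fourier l) x)) \<le> e / 2"
      proof (rule LIMSEQ_le_const2)
        show "(\<lambda>m. \<Sum>x\<in>F. norm (coeff (X n - X m) x)) \<longlonglongrightarrow>
            (\<Sum>x\<in>F. norm (coeff (X n - Fourier l) x))"
          unfolding coeff_diff cl by (intro tendsto_intros l)
        show "\<exists>N. \<forall>m\<ge>N. (\<Sum>x\<in>F. norm (coeff (X n - X m) x)) \<le> e / 2"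
          by (intro exI[of _ M] allI impI order_trans[OF sum_norm_coeff_le[OF F]]
              less_imp_le[OF M[OF n, unfolded dist_norm]])
      qed
    qed
    then show "\<exists>M. \<forall>n\<ge>M. dist (X n) (Fourier l) < e"
      using \<open>0 < e\<close>
      by (intro exI[of _ M] allI impI) (rule le_less_trans[of _ "e / 2"]; simp add: dist_norm)
  qed
  then show "convergent X"
    by (auto simp: convergent_def)
qed

section \<open>The convolution product\<close>

lemma norm_convolution_summable:
  fixes a b :: "('e::ab_group_add, 'a::{banach, real_normed_algebra}) fourier"
  shows "(\<lambda>(x, u). norm (coeff a u * coeff b (x - u))) summable_on UNIV"
    and "(\<Sum>\<^sub>\<infinity>(x, u). norm (coeff a u * coeff b (x - u))) \<le> norm a * norm b"
proof -
  have h: "((\<lambda>(u, v). norm (coeff a u) * norm (coeff b v)) has_sum (norm a * norm b)) (UNIV \<times> UNIV)"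
  proof (rule has_sum_SigmaI)
    show "((\<lambda>v. case (u, v) of (u, v) \<Rightarrow> norm (coeff a u) * norm (coeff b v))
        has_sum (norm (coeff a u) * norm b)) UNIV" for u
      unfolding norm_fourier_def by (simp add: has_sum_cmult_right norm_coeff_summable)
    show "((\<lambda>u. norm (coeff a u) * norm b) has_sum norm a * norm b) UNIV"
      unfolding norm_fourier_def[of a] by (simp add: has_sum_cmult_left norm_coeff_summable)
    then have "(\<lambda>u. norm (coeff a u) * norm b) summable_on UNIV"
      by (rule has_sum_imp_summable)
    then show "(\<lambda>(u, v). norm (coeff a u) * norm (coeff b v)) summable_on UNIV \<times> UNIV"
      by (intro summable_on_SigmaI[where g = "\<lambda>u. norm (coeff a u) * norm b"])
        (auto simp: norm_fourier_def[of b] has_sum_cmult_right norm_coeff_summable)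
  qed
  \<comment> \<open>The substitution \<open>v = x - u\<close> identifies a majorant of the
    convolution terms with the product family, whose sum over all pairs is the product of the
    norms.\<close>
  have bij: "bij_betw (\<lambda>(x, u). (u, x - u)) (UNIV :: ('e \<times> 'e) set) (UNIV \<times> UNIV)"
    by (rule bij_betwI[of _ _ _ "\<lambda>(u, v). (u + v, u)"]) auto
  have h': "((\<lambda>(x, u). norm (coeff a u) * norm (coeff b (x - u))) has_sum (norm a * norm b)) UNIV"
    using has_sum_reindex_bij_betw[OF bij, THEN iffD2, OF h] by (simp add: case_prod_unfold)
  show s: "(\<lambda>(x, u). norm (coeff a u * coeff b (x - u))) summable_on UNIV"
    using has_sum_imp_summable[OF h']
    by (rule summable_on_comparison_test) (auto simp: norm_mult_ineq)
  show "(\<Sum>\<^sub>\<infinity>(x, u). norm (coeff a u * coeff b (x - u))) \<le> norm a * norm b"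
    by (rule has_sum_mono[OF has_sum_infsum[OF s] h']) (auto simp: norm_mult_ineq)
qed

lemma norm_convolution_summable_on:
  fixes a b :: "('e::ab_group_add, 'a::{banach, real_normed_algebra}) fourier"
  shows "(\<lambda>u. norm (coeff a u * coeff b (x - u))) summable_on UNIV"
  using norm_convolution_summable(1)[of a b]
  by (intro summable_on_SigmaD1[of "\<lambda>x u. norm (coeff a u * coeff b (x - u))" UNIV "\<lambda>_. UNIV"]) auto

lemma convolution_summable_on:
  fixes a b :: "('e::ab_group_add, 'a::{banach, real_normed_algebra}) fourier"
  shows "(\<lambda>u. coeff a u * coeff b (x - u)) summable_on UNIV"
  using norm_convolution_summable_on by (rule abs_summable_summable)

instantiation fourier :: (ab_group_add, "{banach, real_normed_algebra}") times
begin

lift_definition times_fourier :: "('a, 'b) fourier \<Rightarrow> ('a, 'b) fourier \<Rightarrow> ('a, 'b) fourier"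
  is "\<lambda>a b x. \<Sum>\<^sub>\<infinity>u. a u * b (x - u)"
proof -
  fix a b :: "'a \<Rightarrow> 'b"
  assume ab: "(\<lambda>x. norm (a x)) summable_on UNIV" "(\<lambda>x. norm (b x)) summable_on UNIV"
  have c: "coeff (Fourier a) = a" "coeff (Fourier b) = b"
    using ab by (simp_all add: Fourier_inverse)
  note s = norm_convolution_summable(1)[of "Fourier a" "Fourier b", unfolded c]
    norm_convolution_summable_on[of "Fourier a" "Fourier b", unfolded c]
  have "(\<lambda>x. \<Sum>\<^sub>\<infinity>u. norm (a u * b (x - u))) summable_on UNIV"
    using s(1) by (intro summable_on_Sigma_banach) auto
  then show "(\<lambda>x. norm (\<Sum>\<^sub>\<infinity>u. a u * b (x - u))) summable_on UNIV"
    by (rule Infinite_Sum.abs_summable_on_comparison_test') (intro norm_infsum_bound s(2))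
qed

instance ..

end

lemma norm_fourier_mult_le:
  fixes a b :: "('e::ab_group_add, 'a::{banach, real_normed_algebra}) fourier"
  shows "norm (a * b) \<le> norm a * norm b"
proof -
  have s: "(\<lambda>x. \<Sum>\<^sub>\<infinity>u. norm (coeff a u * coeff b (x - u))) summable_on UNIV"
    using norm_convolution_summable(1)[of a b] by (intro summable_on_Sigma_banach) auto
  have "norm (a * b) \<le> (\<Sum>\<^sub>\<infinity>x. \<Sum>\<^sub>\<infinity>u. norm (coeff a u * coeff b (x - u)))"
    unfolding norm_fourier_def times_fourier.rep_eq
    using norm_coeff_summable[of "a * b" UNIV]
    by (intro infsum_mono s norm_infsum_bound norm_convolution_summable_on)
      (simp add: times_fourier.rep_eq)
  also have "\<dots> = (\<Sum>\<^sub>\<infinity>(x, u). norm (coeff a u * coeff b (x - u)))"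
    using infsum_Sigma'_banach[of "\<lambda>x u. norm (coeff a u * coeff b (x - u))" UNIV "\<lambda>_. UNIV"]
      norm_convolution_summable(1)[of a b] by simp
  also have "\<dots> \<le> norm a * norm b"
    by (rule norm_convolution_summable(2))
  finally show ?thesis .
qed

section \<open>Complex scalars, projections onto supports, and monomials\<close>

lemma bounded_linear_scaleC_right: "bounded_linear (scaleC c :: 'a \<Rightarrow> 'a::comm_complex_banach_algebra_1)"
proof (rule bounded_linear_intro[of _ "cmod c"])
  show "scaleC c (r *\<^sub>R x) = r *\<^sub>R scaleC c x" for r and x :: 'a
    by (metis scaleC_of_real scaleC_scaleC mult.commute)
qed (simp_all add: scaleC_add_right norm_scaleC mult.commute)

lemma bounded_linear_scaleC_left:
  "bounded_linear (\<lambda>c. scaleC c x :: 'a::comm_complex_banach_algebra_1)"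
proof (rule bounded_linear_intro[of _ "norm x"])
  show "scaleC (r *\<^sub>R c) x = r *\<^sub>R scaleC c x" for r c
    by (metis scaleC_of_real scaleC_scaleC scaleR_conv_of_real)
qed (simp_all add: scaleC_add_left norm_scaleC)

lemma scaleC_one [simp]: "scaleC 1 x = (x :: 'a::comm_complex_banach_algebra_1)"
  using scaleC_of_real[of 1 x] by simp

lemma scaleC_zero [simp]: "scaleC 0 x = (0 :: 'a::comm_complex_banach_algebra_1)"
  using scaleC_of_real[of 0 x] by simp

lemma scaleC_zero_right [simp]: "scaleC c 0 = (0 :: 'a::comm_complex_banach_algebra_1)"
  using bounded_linear.linear[OF bounded_linear_scaleC_right] by (rule linear_0)

lemma mult_scaleC_right: "x * scaleC c y = scaleC c (x * y :: 'a::comm_complex_banach_algebra_1)"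
  by (metis mult.commute mult_scaleC_left)

text \<open>Two cases matter later: for a subgroup this is the projection onto its
  \<open>l^1\<close> algebra, and for a level set of a degree map it is the projection onto a
  homogeneous part.\<close>

lift_definition restrict_coeff :: "'e set \<Rightarrow> ('e, 'a::real_normed_vector) fourier \<Rightarrow> ('e, 'a) fourier"
  is "\<lambda>S a x. if x \<in> S then a x else 0"
proof -
  fix S :: "'e set" and a :: "'e \<Rightarrow> 'a"
  assume "(\<lambda>x. norm (a x)) summable_on UNIV"
  then show "(\<lambda>x. norm (if x \<in> S then a x else 0)) summable_on UNIV"
    by (rule summable_on_comparison_test) auto
qed

text \<open>For frequencies in a Euclidean space, evaluation turns this into the monomial with
  frequency \<open>y\<close>; \<open>single y 1\<close> is then a unit with inverse
  \<open>single (- y) 1\<close>.\<close>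

lift_definition single :: "'e \<Rightarrow> 'a \<Rightarrow> ('e, 'a::real_normed_vector) fourier"
  is "\<lambda>y c x. if x = y then c else 0"
proof -
  fix y :: 'e and c :: 'a
  have "finite {x. norm (if x = y then c else 0) \<noteq> 0}"
    by (rule finite_subset[of _ "{y}"]) (auto split: if_splits)
  then show "(\<lambda>x. norm (if x = y then c else 0)) summable_on UNIV"
    by (intro finite_nonzero_values_imp_summable_on) simp
qed

lemma norm_single [simp]: "norm (single y c) = norm c"
proof -
  have "norm (single y c) = (\<Sum>\<^sub>\<infinity>x\<in>{y}. norm (coeff (single y c) x))"
    unfolding norm_fourier_def by (rule infsum_cong_neutral) (auto simp: single.rep_eq)
  then show ?thesis
    by (simp add: single.rep_eq)
qed

text \<open>Lets the frequency set of an approximation be enlarged at no cost, by one point or to an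
  infinite union of level sets.\<close>

lemma norm_diff_restrict_coeff_mono:
  assumes "\<And>x. x \<in> F \<Longrightarrow> x \<in> T"
  shows "norm (a - restrict_coeff T a) \<le> norm (a - restrict_coeff F a)"
  unfolding norm_fourier_def
  by (intro infsum_mono norm_coeff_summable) (auto simp: coeff_simps restrict_coeff.rep_eq assms)

lemma finite_support_approximation:
  assumes "0 < e"
  obtains F where "finite F" "norm (a - restrict_coeff F a) < e"
proof -
  obtain F where F: "finite F" "dist (\<Sum>x\<in>F. norm (coeff a x)) (norm a) \<le> e / 2"
    using infsum_finite_approximation[OF norm_coeff_summable[of a UNIV], of "e / 2"] assms
    by (auto simp: norm_fourier_def)
  have "norm (a - restrict_coeff F a) = (\<Sum>\<^sub>\<infinity>x\<in>UNIV - F. norm (coeff a x))"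
    unfolding norm_fourier_def
    by (rule infsum_cong_neutral) (auto simp: coeff_diff restrict_coeff.rep_eq)
  also have "\<dots> = norm a - (\<Sum>x\<in>F. norm (coeff a x))"
    using F by (subst infsum_Diff) (auto simp: norm_coeff_summable norm_fourier_def)
  also have "\<dots> \<le> e / 2"
    using F unfolding dist_real_def by linarith
  finally show thesis
    using that[OF F(1)] assms by simp
qed

section \<open>Evaluation and uniqueness of coefficients\<close>

text \<open>For fixed \<open>z\<close> this turns out to be a contractive unital homomorphism into
  \<open>'a\<close>. Together these homomorphisms separate points (\<open>ev_inject\<close>), so
  that identities between families can be checked pointwise.\<close>

definition ev :: "('e::euclidean_space, 'a::comm_complex_banach_algebra_1) fourier \<Rightarrow> 'e \<Rightarrow> 'a"
  where "ev a z = (\<Sum>\<^sub>\<infinity>x. scaleC (cis (x \<bullet> z)) (coeff a x))"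

lemma norm_ev_summable: "(\<lambda>x. norm (scaleC (cis (x \<bullet> z)) (coeff a x))) summable_on A"
  by (simp add: norm_scaleC norm_coeff_summable)

lemma ev_summable: "(\<lambda>x. scaleC (cis (x \<bullet> z)) (coeff a x)) summable_on A"
  by (rule abs_summable_summable[OF norm_ev_summable])

lemma ev_has_sum: "((\<lambda>x. scaleC (cis (x \<bullet> z)) (coeff a x)) has_sum ev a z) UNIV"
  unfolding ev_def by (rule has_sum_infsum[OF ev_summable])

lemma norm_ev_le: "norm (ev a z) \<le> norm a"
proof -
  have "norm (ev a z) \<le> (\<Sum>\<^sub>\<infinity>x. norm (scaleC (cis (x \<bullet> z)) (coeff a x)))"
    unfolding ev_def by (rule norm_infsum_bound[OF norm_ev_summable])
  then show ?thesis
    by (simp add: norm_scaleC norm_fourier_def)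
qed

lemma bounded_linear_ev: "bounded_linear (\<lambda>a. ev a z)"
proof (rule bounded_linear_intro[of _ 1])
  show "ev (a + b) z = ev a z + ev b z" for a b
    unfolding ev_def coeff_simps scaleC_add_right by (rule infsum_add[OF ev_summable ev_summable])
  show "ev (r *\<^sub>R a) z = r *\<^sub>R ev a z" for r a
    unfolding ev_def coeff_simps
    by (subst infsum_scaleR_right[symmetric])
      (simp add: linear_cmul[OF bounded_linear.linear[OF bounded_linear_scaleC_right]])
  show "norm (ev a z) \<le> norm a * 1" for a
    by (simp add: norm_ev_le)
qed

lemmas linear_ev = bounded_linear.linear[OF bounded_linear_ev]
lemmas ev_simps = linear_0[OF linear_ev] linear_add[OF linear_ev] linear_neg[OF linear_ev]
  linear_diff[OF linear_ev] linear_cmul[OF linear_ev]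

lemma ev_single: "ev (single y c) z = scaleC (cis (y \<bullet> z)) c"
proof -
  have "ev (single y c) z = (\<Sum>\<^sub>\<infinity>x\<in>{y}. scaleC (cis (x \<bullet> z)) (coeff (single y c) x))"
    unfolding ev_def by (rule infsum_cong_neutral) (auto simp: single.rep_eq)
  then show ?thesis
    by (simp add: single.rep_eq)
qed

lemma ev_restrict_finite:
  assumes "finite F"
  shows "ev (restrict_coeff F a) z = (\<Sum>x\<in>F. scaleC (cis (x \<bullet> z)) (coeff a x))"
proof -
  have "ev (restrict_coeff F a) z = (\<Sum>\<^sub>\<infinity>x\<in>F. scaleC (cis (x \<bullet> z)) (coeff a x))"
    unfolding ev_def by (rule infsum_cong_neutral) (auto simp: restrict_coeff.rep_eq)
  with assms show ?thesis
    by simp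
qed

text \<open>The phases at \<open>u\<close> and \<open>x - u\<close> multiply to the phase at
  \<open>x\<close>. The absolutely summable double family \<open>A u * B (x - u)\<close> is summed
  in two ways: over \<open>u\<close> first, giving the left side, and after the substitution
  \<open>v = x - u\<close>, giving the right side.\<close>

lemma ev_mult: "ev (a * b) z = ev a z * ev b z"
proof -
  define A where "A x = scaleC (cis (x \<bullet> z)) (coeff a x)" for x
  define B where "B x = scaleC (cis (x \<bullet> z)) (coeff b x)" for x
  have A: "(A has_sum ev a z) UNIV" and B: "(B has_sum ev b z) UNIV"
    unfolding A_def B_def by (rule ev_has_sum)+
  have AB: "A u * B (x - u) = scaleC (cis (x \<bullet> z)) (coeff a u * coeff b (x - u))" for x u
    unfolding A_def B_def
    by (simp add: mult_scaleC_left[of "cis (u \<bullet> z)"] mult_scaleC_right[of "coeff a u"]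
        scaleC_scaleC cis_mult inner_diff_left)
  have "(\<lambda>(x, u). norm (A u * B (x - u))) summable_on UNIV"
    unfolding AB norm_scaleC using norm_convolution_summable(1)[of a b] by simp
  then have s: "(\<lambda>(x, u). A u * B (x - u)) summable_on UNIV \<times> UNIV"
    using abs_summable_summable[of "\<lambda>(x, u). A u * B (x - u)"] by (simp add: case_prod_unfold)
  have c: "((\<lambda>u. A u * B (x - u)) has_sum scaleC (cis (x \<bullet> z)) (coeff (a * b) x)) UNIV" for x
    unfolding AB times_fourier.rep_eq
    by (intro has_sum_bounded_linear[OF bounded_linear_scaleC_right] has_sum_infsum
        convolution_summable_on)
  have 1: "((\<lambda>(x, u). A u * B (x - u)) has_sum ev (a * b) z) (UNIV \<times> UNIV)"
    by (rule has_sum_SigmaI[OF _ ev_has_sum s]) (simp add: c)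
  have bij: "bij_betw (\<lambda>(x, u). (u, x - u)) (UNIV :: ('b \<times> 'b) set) UNIV"
    by (rule bij_betwI[of _ _ _ "\<lambda>(u, v). (u + v, u)"]) auto
  have 2: "((\<lambda>(u, v). A u * B v) has_sum ev (a * b) z) (UNIV \<times> UNIV)"
    using has_sum_reindex_bij_betw[OF bij, of "\<lambda>(u, v). A u * B v"] 1
    by (simp add: case_prod_unfold)
  have "((\<lambda>u. A u * ev b z) has_sum ev (a * b) z) UNIV"
    by (rule has_sum_SigmaD[OF 2]) (auto intro!: has_sum_cmult_right B)
  moreover have "((\<lambda>u. A u * ev b z) has_sum ev a z * ev b z) UNIV"
    by (intro has_sum_cmult_left A)
  ultimately show ?thesis
    by (rule has_sum_unique)
qed

section \<open>Uniqueness of the coefficients by averaging\<close>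

lemma cis_mean_tendsto_0:
  assumes "cis \<mu> \<noteq> 1"
  shows "(\<lambda>N. (\<Sum>k<N. cis (real k * \<mu>)) / of_nat N) \<longlonglongrightarrow> 0"
proof (rule Lim_null_comparison)
  \<comment> \<open>The geometric sum stays bounded as \<open>N\<close> grows, so dividing by
    \<open>N\<close> sends it to 0.\<close>
  have "norm (\<Sum>k<N. cis (real k * \<mu>)) \<le> 2 / norm (1 - cis \<mu>)" for N
  proof -
    have "(\<Sum>k<N. cis (real k * \<mu>)) = (1 - cis \<mu> ^ N) / (1 - cis \<mu>)"
      unfolding Complex.DeMoivre[symmetric] by (subst sum_gp_strict) (simp add: assms)
    moreover have "norm (1 - cis \<mu> ^ N) \<le> 2"
      using norm_triangle_ineq4[of 1 "cis \<mu> ^ N"] by (simp add: norm_power)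
    ultimately show ?thesis
      by (simp add: norm_divide divide_right_mono)
  qed
  then show "\<forall>\<^sub>F N in sequentially. norm ((\<Sum>k<N. cis (real k * \<mu>)) / of_nat N)
      \<le> 2 / norm (1 - cis \<mu>) / real N"
    by (intro always_eventually allI) (metis norm_divide norm_of_nat divide_right_mono of_nat_0_le_iff)
  show "(\<lambda>N. 2 / norm (1 - cis \<mu>) / real N) \<longlonglongrightarrow> 0"
    by (rule tendsto_divide_0[OF tendsto_const filterlim_real_at_infinity_sequentially])
qed

text \<open>The vectors to avoid lie on countably many hyperplanes, one for each \<open>x\<close> in
  \<open>F\<close> and each integer \<open>k\<close>. These are null sets and cannot cover the
  space.\<close>

lemma generic_direction:
  fixes F :: "'e::euclidean_space set"
  assumes "finite F" "0 \<notin> F"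
  obtains v where "\<And>x. x \<in> F \<Longrightarrow> cis (x \<bullet> v) \<noteq> 1"
proof -
  define H where "H = (\<Union>(x, k)\<in>F \<times> (UNIV :: int set). {v. x \<bullet> v = 2 * pi * of_int k})"
  have "negligible H"
    unfolding H_def using assms
    by (intro negligible_countable_Union countable_image countable_SIGMA countable_finite
        countableI_type) (auto intro!: negligible_hyperplane)
  then have "H \<noteq> UNIV"
    by (metis non_negligible_UNIV)
  then obtain v where v: "v \<notin> H"
    by auto
  show thesis
  proof (rule that)
    fix x
    assume "x \<in> F"
    show "cis (x \<bullet> v) \<noteq> 1"
    proof
      assume "cis (x \<bullet> v) = 1"
      then have "cos (x \<bullet> v) = 1"
        by (metis cis.sel(1) one_complex.sel(1))
      then obtain k :: int where "x \<bullet> v = of_int k * 2 * pi"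
        by (auto simp: cos_one_2pi_int)
      with v \<open>x \<in> F\<close> show False
        by (auto simp: H_def mult_ac)
    qed
  qed
qed

text \<open>Averaging \<open>e\<^sup>-\<^sup>i\<^sup>x\<^sup>0\<^sup>z f(z)\<close> over the multiples of a generic vector isolates the coefficient at \<open>x0\<close>.\<close>

lemma norm_coeff_le_bound_ev:
  assumes "\<And>z. norm (ev a z) \<le> e"
  shows "norm (coeff a x0) \<le> e"
proof (rule field_le_epsilon)
  fix d :: real
  assume "0 < d"
  then obtain F0 where F0: "finite F0" "norm (a - restrict_coeff F0 a) < d"
    by (rule finite_support_approximation)
  \<comment> \<open>The frequency \<open>x0\<close> is adjoined so that its coefficient is certain
    to occur in the finite sums that are averaged.\<close>
  define F where "F = insert x0 F0"
  have "norm (a - restrict_coeff F a) \<le> norm (a - restrict_coeff F0 a)"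
    by (rule norm_diff_restrict_coeff_mono) (simp add: F_def)
  then have F: "finite F" "norm (a - restrict_coeff F a) < d" "x0 \<in> F"
    using F0 by (simp_all add: F_def)
  have bound: "norm (ev (restrict_coeff F a) z) \<le> e + d" for z
  proof -
    have "norm (ev (restrict_coeff F a) z) \<le> norm (ev a z) + norm (ev (a - restrict_coeff F a) z)"
      unfolding ev_simps by (metis norm_minus_commute norm_triangle_sub)
    also have "\<dots> \<le> e + d"
      using norm_ev_le[of "a - restrict_coeff F a" z] F assms[of z] by simp
    finally show ?thesis .
  qed
  \<comment> \<open>All differences \<open>x - x0\<close> with \<open>x\<close> in \<open>F\<close>
    other than \<open>x0\<close> are non-zero, so a generic \<open>v\<close> makes the mean of every
    one of these frequencies vanish in the limit.\<close>
  obtain v where v: "\<And>y. y \<in> (\<lambda>x. x - x0) ` (F - {x0}) \<Longrightarrow> cis (y \<bullet> v) \<noteq> 1"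
    by (rule generic_direction[of "(\<lambda>x. x - x0) ` (F - {x0})"]) (use F in auto)
  define M where "M N x = (\<Sum>k<N. cis (real k * ((x - x0) \<bullet> v))) / of_nat N" for N x
  have M: "(\<lambda>N. M N x) \<longlonglongrightarrow> (if x = x0 then 1 else 0)" if "x \<in> F" for x
  proof (cases "x = x0")
    case True
    have "M N x0 = 1" if "N > 0" for N
      using that by (simp add: M_def)
    then have "\<forall>\<^sub>F N in sequentially. M N x0 = 1"
      by (auto intro: eventually_sequentiallyI[of 1])
    then show ?thesis
      using True by (simp add: tendsto_eventually)
  next
    case False
    with that show ?thesis
      unfolding M_def by (auto intro!: cis_mean_tendsto_0 v)
  qed
  \<comment> \<open>Averaging the values at the points \<open>k v\<close>, with the phase of
    \<open>x0\<close> removed, multiplies the coefficient at \<open>x\<close> by the mean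
    \<open>M N x\<close>. Each averaged value has norm at most \<open>e + d\<close>.\<close>
  have eq: "(\<Sum>x\<in>F. scaleC (M N x) (coeff a x)) = (1 / real N) *\<^sub>R
      (\<Sum>k<N. scaleC (cis (- (real k * (x0 \<bullet> v)))) (ev (restrict_coeff F a) (real k *\<^sub>R v)))" for N
  proof -
    have "scaleC (M N x) (coeff a x) = (1 / real N) *\<^sub>R (\<Sum>k<N. scaleC (cis (- (real k * (x0 \<bullet> v))))
        (scaleC (cis (x \<bullet> real k *\<^sub>R v)) (coeff a x)))" for x
    proof -
      have "scaleC (M N x) (coeff a x) =
          scaleC ((1 / real N) *\<^sub>R (\<Sum>k<N. cis (real k * ((x - x0) \<bullet> v)))) (coeff a x)"
        by (simp add: M_def scaleR_conv_of_real)
      also have "\<dots> = (1 / real N) *\<^sub>R (\<Sum>k<N. scaleC (cis (real k * ((x - x0) \<bullet> v))) (coeff a x))"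
        by (simp only: linear_cmul[OF bounded_linear.linear[OF bounded_linear_scaleC_left]]
            linear_sum[OF bounded_linear.linear[OF bounded_linear_scaleC_left]])
      finally show ?thesis
        by (simp add: scaleC_scaleC cis_mult inner_diff_left right_diff_distrib)
    qed
    then show ?thesis
      unfolding ev_restrict_finite[OF F(1)]
        linear_sum[OF bounded_linear.linear[OF bounded_linear_scaleC_right]]
      by (subst sum.swap) (simp add: scaleR_sum_right)
  qed
  show "norm (coeff a x0) \<le> e + d"
  proof (rule LIMSEQ_le_const2)
    have "(\<lambda>N. \<Sum>x\<in>F. scaleC (M N x) (coeff a x)) \<longlonglongrightarrow>
        (\<Sum>x\<in>F. scaleC (if x = x0 then 1 else 0) (coeff a x))"
      by (intro tendsto_sum bounded_linear.tendsto[OF bounded_linear_scaleC_left] M)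
    also have "(\<Sum>x\<in>F. scaleC (if x = x0 then 1 else 0) (coeff a x)) =
        (\<Sum>x\<in>F. if x = x0 then coeff a x else 0)"
      by (rule sum.cong) auto
    also have "\<dots> = coeff a x0"
      using F by simp
    finally show "(\<lambda>N. norm (\<Sum>x\<in>F. scaleC (M N x) (coeff a x))) \<longlonglongrightarrow> norm (coeff a x0)"
      by (rule tendsto_norm)
    have "norm (\<Sum>x\<in>F. scaleC (M N x) (coeff a x)) \<le> e + d" if "N > 0" for N
    proof -
      have "norm (\<Sum>k<N. scaleC (cis (- (real k * (x0 \<bullet> v)))) (ev (restrict_coeff F a) (real k *\<^sub>R v)))
          \<le> (\<Sum>k<N. e + d)"
        by (rule sum_norm_le) (simp add: norm_scaleC bound)
      with that show ?thesis
        unfolding eq by (simp add: field_simps)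
    qed
    then show "\<exists>N. \<forall>n\<ge>N. norm (\<Sum>x\<in>F. scaleC (M n x) (coeff a x)) \<le> e + d"
      by (intro exI[of _ 1]) auto
  qed
qed

lemma ev_inject:
  assumes "\<And>z. ev a z = ev b z"
  shows "a = b"
proof (rule fourier_eqI)
  fix x
  have "norm (coeff (a - b) x) \<le> 0"
    using assms by (intro norm_coeff_le_bound_ev) (simp add: ev_simps)
  then show "coeff a x = coeff b x"
    by (simp add: coeff_diff)
qed

instantiation fourier :: (euclidean_space, comm_complex_banach_algebra_1) one
begin

definition one_fourier :: "('a, 'b) fourier"
  where "one_fourier = single 0 1"

instance ..

end

lemma ev_one: "ev 1 z = 1"
  by (simp add: one_fourier_def ev_single)

instance fourier :: (euclidean_space, comm_complex_banach_algebra_1) comm_ring_1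
proof
  fix a b c :: "('a, 'b) fourier"
  \<comment> \<open>By \<open>ev_inject\<close> the laws are inherited from \<open>'a\<close> point
    by point, and no multiple sum has to be rearranged.\<close>
  show "a * b * c = a * (b * c)" "a * b = b * a" "1 * a = a" "(a + b) * c = a * c + b * c"
    by (rule ev_inject; simp add: ev_mult ev_simps ev_one algebra_simps)+
  have "ev (0 :: ('a, 'b) fourier) 0 \<noteq> ev 1 0"
    by (simp add: ev_one ev_simps)
  then show "(0 :: ('a, 'b) fourier) \<noteq> 1"
    by metis
qed

instance fourier :: (euclidean_space, comm_complex_banach_algebra_1) real_normed_algebra_1
proof
  fix a b :: "('a, 'b) fourier" and r :: real
  show "r *\<^sub>R a * b = r *\<^sub>R (a * b)" "a * r *\<^sub>R b = r *\<^sub>R (a * b)"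
    by (rule ev_inject; simp add: ev_mult ev_simps)+
  show "norm (a * b) \<le> norm a * norm b"
    by (rule norm_fourier_mult_le)
  show "norm (1 :: ('a, 'b) fourier) = 1"
    by (simp add: one_fourier_def)
qed

section \<open>Exponentials and logarithms\<close>

text \<open>The tail of the power series is dominated term by term by that of the real exponential
  at \<open>norm x\<close>, where the quadratic bound on the unit interval is known.\<close>

lemma norm_exp_diff_le:
  fixes x :: "'b::{banach, real_normed_algebra_1}"
  assumes "norm x \<le> 1"
  shows "norm (exp x - 1 - x) \<le> (norm x)\<^sup>2"
proof -
  define c where "c n = (inverse (fact (n + 2)) :: real)" for n
  have s: "summable (\<lambda>n. c n * norm x ^ (n + 2))"
    using summable_ignore_initial_segment[OF summable_exp_generic[of "norm x"], of 2]
    by (simp add: c_def)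
  have "exp x - 1 - x = (\<Sum>n. c n *\<^sub>R x ^ (n + 2))"
    using exp_first_two_terms[of x] by (simp add: c_def)
  moreover have le: "norm (c n *\<^sub>R x ^ (n + 2)) \<le> c n * norm x ^ (n + 2)" for n
    unfolding norm_scaleR using norm_power_ineq[of x "n + 2"]
    by (simp add: c_def del: power_add power_Suc add_2_eq_Suc')
  moreover have "norm (\<Sum>n. c n *\<^sub>R x ^ (n + 2)) \<le> (\<Sum>n. c n * norm x ^ (n + 2))"
    by (rule norm_suminf_le[OF le s])
  moreover have "(\<Sum>n. c n * norm x ^ (n + 2)) = exp (norm x) - 1 - norm x"
    using exp_first_two_terms[of "norm x"] by (simp add: c_def)
  moreover have "exp (norm x) \<le> 1 + norm x + (norm x)\<^sup>2"
    using assms by (intro exp_bound) auto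
  ultimately show ?thesis
    by simp
qed

text \<open>A logarithm of \<open>a\<close> is a fixed point of \<open>l \<mapsto> l + a - exp l\<close>, a contraction near 0.\<close>

lemma exists_log_near_1:
  fixes a :: "'b::{banach, real_normed_algebra_1, comm_ring_1}"
  assumes "norm (a - 1) < 1 / 16"
  obtains l where "exp l = a"
proof -
  define P where "P l = l + a - exp l" for l
  have "\<exists>!l\<in>cball 0 (1 / 8). P l = l"
  proof (rule Banach_fix[where c = "1 / 2"])
    show "P ` cball 0 (1 / 8) \<subseteq> cball 0 (1 / 8)"
    proof clarify
      fix l :: 'b
      assume "l \<in> cball 0 (1 / 8)"
      then have l: "norm l \<le> 1 / 8"
        by simp
      have "(norm l)\<^sup>2 \<le> (1 / 8)\<^sup>2"
        using l by (intro power_mono) auto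
      \<comment> \<open>Since \<open>P l = (a - 1) - (exp l - 1 - l)\<close>, the ball is preserved
        because \<open>1/16 + 1/64 < 1/8\<close>.\<close>
      moreover have "norm (P l) \<le> norm (a - 1) + norm (exp l - 1 - l)"
        using norm_triangle_ineq4[of "a - 1" "exp l - 1 - l"] by (simp add: P_def algebra_simps)
      ultimately have "norm (P l) \<le> 1 / 8"
        using norm_exp_diff_le[of l] assms l by (simp add: power2_eq_square)
      then show "P l \<in> cball 0 (1 / 8)"
        by simp
    qed
    show "dist (P l) (P k) \<le> 1 / 2 * dist l k"
      if "l \<in> cball 0 (1 / 8)" "k \<in> cball 0 (1 / 8)" for l k
    proof -
      define d where "d = l - k"
      have l: "norm l \<le> 1 / 8" and k: "norm k \<le> 1 / 8"
        using that by simp_all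
      then have d: "norm d \<le> 1 / 4"
        unfolding d_def by norm
      have e: "exp l = exp k * exp d"
        using exp_add_commuting[of k d] by (simp add: d_def mult.commute)
      have "P l - P k = - (exp k * (exp d - 1 - d) + (exp k - 1) * d)"
        unfolding P_def e by (simp add: d_def algebra_simps)
      then have "norm (P l - P k) = norm (exp k * (exp d - 1 - d) + (exp k - 1) * d)"
        by (simp only: norm_minus_cancel)
      also have "\<dots> \<le> norm (exp k) * norm (exp d - 1 - d) + norm (exp k - 1) * norm d"
        using norm_triangle_ineq[of "exp k * (exp d - 1 - d)" "(exp k - 1) * d"]
          norm_mult_ineq[of "exp k" "exp d - 1 - d"] norm_mult_ineq[of "exp k - 1" d]
        by linarith
      \<comment> \<open>The constants are matched to the contraction factor:
        \<open>5/4 * 1/4 + 3/16 = 1/2\<close>.\<close>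
      also have "\<dots> \<le> 5 / 4 * (1 / 4 * norm d) + 3 / 16 * norm d"
      proof (intro add_mono mult_mono)
        have "(norm k)\<^sup>2 \<le> (1 / 8)\<^sup>2"
          using k by (intro power_mono) auto
        then have 1: "norm (exp k - 1 - k) \<le> 1 / 64"
          using norm_exp_diff_le[of k] k by (simp add: power2_eq_square)
        show 2: "norm (exp k - 1) \<le> 3 / 16"
          using norm_triangle_ineq[of "exp k - 1 - k" k] 1 k by simp
        show "norm (exp k) \<le> 5 / 4"
          using norm_triangle_ineq[of "exp k - 1" 1] 2 by simp
        have "norm (exp d - 1 - d) \<le> norm d * norm d"
          using norm_exp_diff_le[of d] d by (simp add: power2_eq_square)
        also have "\<dots> \<le> 1 / 4 * norm d"
          using d by (intro mult_right_mono) auto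
        finally show "norm (exp d - 1 - d) \<le> 1 / 4 * norm d" .
      qed auto
      also have "\<dots> \<le> 1 / 2 * norm d"
        by simp
      finally show ?thesis
        by (simp add: dist_norm d_def)
    qed
  qed (auto simp: complete_eq_closed)
  then obtain l where "P l = l"
    by blast
  then show thesis
    using that by (simp add: P_def)
qed

text \<open>Boundedness lets \<open>h\<close> pass through the power series. The lemma serves both
  for evaluation at a point and for the embedding of the complex scalars.\<close>

lemma exp_homomorphism:
  fixes h :: "'b::{banach, real_normed_algebra_1} \<Rightarrow> 'c::{banach, real_normed_algebra_1}"
  assumes "bounded_linear h" "h 1 = 1" "\<And>x y. h (x * y) = h x * h y"
  shows "h (exp x) = exp (h x)"
proof -
  have "h (x ^ n /\<^sub>R fact n) = h x ^ n /\<^sub>R fact n" for n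
    using assms(2,3) linear_cmul[OF bounded_linear.linear[OF assms(1)]] by (induction n) auto
  then have "(\<lambda>n. h x ^ n /\<^sub>R fact n) sums h (exp x)"
    using bounded_linear.sums[OF assms(1) exp_converges[of x]] by simp
  then show ?thesis
    using exp_converges sums_unique2 by blast
qed

lemma ev_exp: "ev (exp a) z = exp (ev a z)"
  by (rule exp_homomorphism[OF bounded_linear_ev]) (simp_all add: ev_one ev_mult)

section \<open>Supports and derivations\<close>

definition additive_subgroup :: "'e::ab_group_add set \<Rightarrow> bool"
  where "additive_subgroup G \<longleftrightarrow> 0 \<in> G \<and> (\<forall>x\<in>G. \<forall>y\<in>G. x - y \<in> G)"

lemma additive_subgroupD:
  assumes "additive_subgroup G"
  shows "0 \<in> G" "x \<in> G \<Longrightarrow> y \<in> G \<Longrightarrow> x - y \<in> G" "x \<in> G \<Longrightarrow> - x \<in> G"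
    "x \<in> G \<Longrightarrow> y \<in> G \<Longrightarrow> x + y \<in> G" "y \<in> G \<Longrightarrow> x - y \<in> G \<longleftrightarrow> x \<in> G"
proof -
  show 0: "0 \<in> G" and diff: "\<And>x y. x \<in> G \<Longrightarrow> y \<in> G \<Longrightarrow> x - y \<in> G"
    using assms by (auto simp: additive_subgroup_def)
  show neg: "\<And>x. x \<in> G \<Longrightarrow> - x \<in> G"
    using diff[OF 0] by fastforce
  show add: "x \<in> G \<Longrightarrow> y \<in> G \<Longrightarrow> x + y \<in> G" for x y
    using diff[of x "- y"] neg by simp
  show "y \<in> G \<Longrightarrow> x - y \<in> G \<longleftrightarrow> x \<in> G"
    using diff add[of "x - y" y] by auto
qed

lemma additive_subgroup_add_generator:
  fixes y :: "'e::real_vector"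
  assumes "additive_subgroup G"
  shows "additive_subgroup {x. \<exists>k :: int. x - of_int k *\<^sub>R y \<in> G}" (is "additive_subgroup ?H")
  unfolding additive_subgroup_def
proof (intro conjI ballI)
  have "0 - of_int 0 *\<^sub>R y \<in> G"
    using additive_subgroupD(1)[OF assms] by simp
  then show "0 \<in> ?H"
    by blast
  fix x u
  assume "x \<in> ?H" "u \<in> ?H"
  then obtain j k :: int where "x - of_int j *\<^sub>R y \<in> G" "u - of_int k *\<^sub>R y \<in> G"
    by blast
  then have "x - u - of_int (j - k) *\<^sub>R y \<in> G"
    using additive_subgroupD(2)[OF assms, of "x - of_int j *\<^sub>R y" "u - of_int k *\<^sub>R y"]
    by (simp add: algebra_simps)
  then show "x - u \<in> ?H"
    by blast
qed

definition supported :: "'e set \<Rightarrow> ('e, 'a::real_normed_vector) fourier \<Rightarrow> bool"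
  where "supported S a \<longleftrightarrow> (\<forall>x. x \<notin> S \<longrightarrow> coeff a x = 0)"

lemma supported_simple:
  shows "supported S 0" "supported S a \<Longrightarrow> supported S b \<Longrightarrow> supported S (a + b)"
    "supported S a \<Longrightarrow> supported S (r *\<^sub>R a)"
    "supported S (restrict_coeff S c)"
    "supported S c \<Longrightarrow> restrict_coeff S c = c"
    "x \<in> S \<Longrightarrow> supported S (single x k)"
  by (auto simp: supported_def coeff_simps restrict_coeff.rep_eq single.rep_eq intro!: fourier_eqI)

lemma supported_LIMSEQ:
  assumes "X \<longlonglongrightarrow> a" "\<And>n. supported S (X n)"
  shows "supported S a"
  unfolding supported_def
proof (intro allI impI)
  fix x
  assume "x \<notin> S"
  then have "(\<lambda>n. coeff (X n) x) = (\<lambda>_. 0)"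
    using assms(2) by (auto simp: supported_def)
  then show "coeff a x = 0"
    using bounded_linear.tendsto[OF bounded_linear_coeff assms(1), of x]
    by (simp add: LIMSEQ_const_iff)
qed

lemma supported_mult:
  assumes "additive_subgroup G" "supported G a" "supported G b"
  shows "supported G (a * b)"
  unfolding supported_def
proof (intro allI impI)
  fix x
  assume "x \<notin> G"
  then have "coeff a u * coeff b (x - u) = 0" for u
    using assms(2,3) additive_subgroupD(5)[OF assms(1), of u x] unfolding supported_def
    by (cases "u \<in> G") auto
  then show "coeff (a * b) x = 0"
    by (simp add: times_fourier.rep_eq)
qed

lemma supported_1: "additive_subgroup G \<Longrightarrow> supported G 1"
  unfolding one_fourier_def by (intro supported_simple additive_subgroupD)

lemma supported_exp:
  assumes "additive_subgroup G" "supported G a"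
  shows "supported G (exp a)"
proof (rule supported_LIMSEQ)
  show "(\<lambda>N. \<Sum>n<N. a ^ n /\<^sub>R fact n) \<longlonglongrightarrow> exp a"
    using exp_converges[of a] by (simp add: sums_def)
  have "supported G (a ^ n)" for n
    by (induction n) (auto intro: supported_1 supported_mult assms)
  then show "supported G (\<Sum>n<N. a ^ n /\<^sub>R fact n)" for N
    by (induction N) (auto intro: supported_simple)
qed

text \<open>Translation by the frequencies of \<open>a\<close> maps \<open>T\<close> and its
  complement to themselves, so multiplication by \<open>a\<close> commutes with the projection.
  Below, \<open>T\<close> is either a subgroup or the set of frequencies of one degree.\<close>

lemma restrict_coeff_mult:
  fixes a b :: "('e::ab_group_add, 'a::{banach, real_normed_algebra}) fourier"
  assumes "supported S a" "\<And>x u. u \<in> S \<Longrightarrow> x - u \<in> T \<longleftrightarrow> x \<in> T"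
  shows "restrict_coeff T (a * b) = a * restrict_coeff T b"
proof (rule fourier_eqI)
  fix x
  have "coeff a u * coeff (restrict_coeff T b) (x - u) =
      (if x \<in> T then coeff a u * coeff b (x - u) else 0)" for u
    using assms by (cases "u \<in> S") (auto simp: supported_def restrict_coeff.rep_eq)
  then show "coeff (restrict_coeff T (a * b)) x = coeff (a * restrict_coeff T b) x"
    by (simp add: times_fourier.rep_eq restrict_coeff.rep_eq)
qed

text \<open>Projecting \<open>b\<close> to \<open>G\<close> gives another inverse of
  \<open>a\<close>, and inverses are unique.\<close>

lemma supported_inverse:
  assumes G: "additive_subgroup G" "supported G a" and ab: "a * b = 1"
  shows "supported G b"
proof -
  have "a * restrict_coeff G b = restrict_coeff G (a * b)"
    using restrict_coeff_mult[OF G(2)] additive_subgroupD(5)[OF G(1)] by metis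
  also have "\<dots> = 1"
    unfolding ab by (rule supported_simple(5)[OF supported_1[OF G(1)]])
  finally have "restrict_coeff G b = b"
    by (metis ab mult.commute mult.left_commute mult_1)
  then show ?thesis
    by (metis supported_simple(4))
qed

text \<open>A relation rather than an operator: for an unbounded weight \<open>m\<close> the
  weighted coefficients may fail to be absolutely summable, and then no derivative exists in the
  algebra.\<close>

definition is_derivation_of :: "('e \<Rightarrow> real) \<Rightarrow> ('e, 'a::real_normed_vector) fourier \<Rightarrow> ('e, 'a) fourier \<Rightarrow> bool"
  where "is_derivation_of m a a' \<longleftrightarrow> (\<forall>x. coeff a' x = m x *\<^sub>R coeff a x)"

text \<open>Leibniz' rule: in each term of the convolution the weight splits as
  \<open>m x = m u + m (x - u)\<close>. Terms with a frequency outside \<open>G\<close> vanish, so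
  additivity on \<open>G\<close> is enough.\<close>

lemma derivation_mult:
  fixes a b :: "('e::ab_group_add, 'a::{banach, real_normed_algebra}) fourier"
  assumes m: "\<And>x u. x \<in> G \<Longrightarrow> u \<in> G \<Longrightarrow> m (x + u) = m x + m u"
    and s: "supported G a" "supported G b"
    and d: "is_derivation_of m a a'" "is_derivation_of m b b'"
  shows "is_derivation_of m (a * b) (a' * b + a * b')"
  unfolding is_derivation_of_def
proof
  fix x
  have "coeff a' u * coeff b (x - u) + coeff a u * coeff b' (x - u) =
      m x *\<^sub>R (coeff a u * coeff b (x - u))" for u
  proof (cases "u \<in> G \<and> x - u \<in> G")
    case True
    then have "m x = m u + m (x - u)"
      using m[of u "x - u"] by simp
    then show ?thesis
      using d by (simp add: is_derivation_of_def scaleR_left_distrib)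
  next
    case False
    then show ?thesis
      using d s by (auto simp: is_derivation_of_def supported_def)
  qed
  then show "coeff (a' * b + a * b') x = m x *\<^sub>R coeff (a * b) x"
    unfolding plus_fourier.rep_eq times_fourier.rep_eq
    by (simp add: infsum_add[symmetric] convolution_summable_on infsum_scaleR_right)
qed

text \<open>The derivation may be unbounded and cannot be moved through the norm-convergent series.
  At a fixed frequency it is multiplication by the number \<open>m x\<close>, so the series are
  compared one coefficient at a time.\<close>

lemma derivation_exp:
  fixes a :: "('e::euclidean_space, 'a::comm_complex_banach_algebra_1) fourier"
  assumes G: "additive_subgroup G"
    and m: "\<And>x u. x \<in> G \<Longrightarrow> u \<in> G \<Longrightarrow> m (x + u) = m x + m u"
    and s: "supported G a" and d: "is_derivation_of m a a'"
  shows "is_derivation_of m (exp a) (exp a * a')"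
proof -
  have m0: "m 0 = 0"
    using m[of 0 0] additive_subgroupD(1)[OF G] by simp
  have pow: "supported G (a ^ n)" for n
    by (induction n) (auto intro: supported_1 supported_mult G s)
  have dpow: "is_derivation_of m (a ^ Suc n) (of_nat (Suc n) * a ^ n * a')" for n
  proof (induction n)
    case 0
    then show ?case
      using d by simp
  next
    case (Suc n)
    show ?case
      using derivation_mult[OF m s pow d Suc] by (simp add: algebra_simps)
  qed
  show ?thesis
    unfolding is_derivation_of_def
  proof
    fix x
    have "(\<lambda>n. a ^ Suc n /\<^sub>R fact (Suc n)) sums (exp a - 1)"
      using sums_split_initial_segment[OF exp_converges[of a], of 1] by simp
    then have 1: "(\<lambda>n. m x *\<^sub>R coeff (a ^ Suc n /\<^sub>R fact (Suc n)) x) sums (m x *\<^sub>R coeff (exp a - 1) x)"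
      by (intro bounded_linear.sums[OF bounded_linear_scaleR_right]
          bounded_linear.sums[OF bounded_linear_coeff])
    have "m x *\<^sub>R coeff (a ^ Suc n /\<^sub>R fact (Suc n)) x = coeff (a ^ n /\<^sub>R fact n * a') x" for n
    proof -
      have "m x *\<^sub>R coeff (a ^ Suc n /\<^sub>R fact (Suc n)) x =
          inverse (fact (Suc n)) *\<^sub>R coeff (of_nat (Suc n) * a ^ n * a') x"
        using dpow[of n] by (simp add: is_derivation_of_def coeff_simps mult.commute del: power_Suc of_nat_Suc)
      also have "of_nat (Suc n) * a ^ n * a' = real (Suc n) *\<^sub>R (a ^ n * a')"
        by (simp add: scaleR_conv_of_real mult.assoc del: of_nat_Suc)
      also have "inverse (fact (Suc n)) *\<^sub>R coeff \<dots> x = coeff (a ^ n /\<^sub>R fact n * a') x"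
        by (simp add: coeff_simps field_simps del: of_nat_Suc)
      finally show ?thesis .
    qed
    moreover have "(\<lambda>n. a ^ n /\<^sub>R fact n * a') sums (exp a * a')"
      by (rule sums_mult2[OF exp_converges])
    then have "(\<lambda>n. coeff (a ^ n /\<^sub>R fact n * a') x) sums coeff (exp a * a') x"
      by (rule bounded_linear.sums[OF bounded_linear_coeff])
    ultimately have "m x *\<^sub>R coeff (exp a - 1) x = coeff (exp a * a') x"
      using 1 sums_unique2 by auto
    \<comment> \<open>The subtracted 1 lives at frequency 0, where \<open>m\<close>
      vanishes.\<close>
    then show "coeff (exp a * a') x = m x *\<^sub>R coeff (exp a) x"
      using m0 by (cases "x = 0") (auto simp: coeff_simps one_fourier_def single.rep_eq)
  qed
qed

section \<open>Characters\<close>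

lemma gelfand_spaceD:
  assumes "\<phi> \<in> gelfand_space"
  shows "\<phi> (a + b) = \<phi> a + \<phi> b" "\<phi> (scaleC c a) = c * \<phi> a" "\<phi> (a * b) = \<phi> a * \<phi> b" "\<phi> 1 = 1"
proof -
  show "\<phi> (a + b) = \<phi> a + \<phi> b" "\<phi> (scaleC c a) = c * \<phi> a" and m: "\<And>a b. \<phi> (a * b) = \<phi> a * \<phi> b"
    using assms by (auto simp: gelfand_space_def)
  obtain a where "\<phi> a \<noteq> 0"
    using assms by (auto simp: gelfand_space_def)
  with m[of 1 a] show "\<phi> 1 = 1"
    by simp
qed

text \<open>Otherwise rescaling gives \<open>b\<close> with \<open>norm b < 1\<close> and value 1
  under the character. The Neumann series \<open>s\<close> of \<open>b\<close> satisfies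
  \<open>s = 1 + b * s\<close>, and applying the character yields a contradiction.\<close>

lemma norm_character_le:
  assumes "\<phi> \<in> gelfand_space"
  shows "cmod (\<phi> a) \<le> norm a"
proof (rule ccontr)
  assume "\<not> cmod (\<phi> a) \<le> norm a"
  then have a: "norm a < cmod (\<phi> a)" "\<phi> a \<noteq> 0"
    by auto
  define b where "b = scaleC (1 / \<phi> a) a"
  have b: "norm b < 1" "\<phi> b = 1"
    using a gelfand_spaceD(2)[OF assms] by (auto simp: b_def norm_scaleC norm_divide field_simps)
  have s: "summable (\<lambda>n. b ^ n)"
    by (rule summable_comparison_test'[OF summable_geometric[of "norm b"]]) (use b norm_power_ineq in auto)
  have "(\<Sum>n. b ^ n) = 1 + b * (\<Sum>n. b ^ n)"
    using suminf_split_head[OF s] suminf_mult[OF s, of b] by simp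
  then have "\<phi> (\<Sum>n. b ^ n) = 1 + \<phi> (\<Sum>n. b ^ n)"
    using gelfand_spaceD[OF assms] b(2) by (metis mult_1)
  then show False
    by simp
qed

lemma bounded_linear_character:
  assumes "\<phi> \<in> gelfand_space"
  shows "bounded_linear \<phi>"
proof (rule bounded_linear_intro[of _ 1])
  show "\<phi> (r *\<^sub>R x) = r *\<^sub>R \<phi> x" for r x
    using gelfand_spaceD(2)[OF assms, of "complex_of_real r" x]
    by (simp add: scaleC_of_real scaleR_conv_of_real)
qed (simp_all add: gelfand_spaceD[OF assms] norm_character_le[OF assms])

text \<open>The norms of the coefficients form a majorant independent of \<open>z\<close>, so the
  finite partial sums converge uniformly.\<close>

lemma continuous_on_ev: "continuous_on UNIV (ev a)"
proof -
  have c: "continuous_on UNIV (\<lambda>z. scaleC (cis (x \<bullet> z)) (coeff a x))" for x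
    by (intro bounded_linear.continuous_on[OF bounded_linear_scaleC_left] continuous_intros)
  have "uniform_limit UNIV (\<lambda>F z. \<Sum>x\<in>F. scaleC (cis (x \<bullet> z)) (coeff a x))
      (\<lambda>z. \<Sum>\<^sub>\<infinity>x. scaleC (cis (x \<bullet> z)) (coeff a x)) (finite_subsets_at_top UNIV)"
    by (rule Weierstrass_m_test_general[OF _ norm_coeff_summable[of a]]) (simp add: norm_scaleC)
  then have "continuous_on UNIV (\<lambda>z. \<Sum>\<^sub>\<infinity>x. scaleC (cis (x \<bullet> z)) (coeff a x))"
    by (rule uniform_limit_theorem[rotated]) (auto intro!: always_eventually continuous_on_sum c)
  then show ?thesis
    by (simp add: ev_def[abs_def])
qed

lemma semisimple_eq_0:
  fixes a :: "'a::comm_complex_banach_algebra_1"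
  assumes "semisimple TYPE('a)" "\<And>\<phi>. \<phi> \<in> gelfand_space \<Longrightarrow> \<phi> a = 0"
  shows "a = 0"
  using assms unfolding semisimple_def by blast

text \<open>The integers are discrete, so a level set of the evaluation at \<open>a\<close> is open
  and closed. Connectedness leaves a single value, and semisimplicity lifts equality under all
  characters to equality in the algebra.\<close>

lemma Ints_valued_character_constant:
  fixes a :: "'a::comm_complex_banach_algebra_1"
  assumes ss: "semisimple TYPE('a)"
    and conn: "connected_space (gelfand_topology :: ('a \<Rightarrow> complex) topology)"
    and int: "\<And>\<phi>. \<phi> \<in> gelfand_space \<Longrightarrow> \<phi> a \<in> \<int>"
  obtains N :: int where "a = of_int N"
proof -
  have op: "openin gelfand_topology {\<phi> \<in> gelfand_space. \<phi> a \<in> U}" if "open U" for U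
    unfolding gelfand_topology_def using that by (intro topology_generated_by_Basis) auto
  have top: "topspace gelfand_topology = (gelfand_space :: ('a \<Rightarrow> complex) set)"
  proof
    show "topspace gelfand_topology \<subseteq> (gelfand_space :: ('a \<Rightarrow> complex) set)"
      unfolding gelfand_topology_def topology_generated_by_topspace by auto
    show "(gelfand_space :: ('a \<Rightarrow> complex) set) \<subseteq> topspace gelfand_topology"
      using openin_subset[OF op[OF open_UNIV]] by simp
  qed
  \<comment> \<open>Semisimplicity applied to the non-zero element 1 shows that there is a character
    at all.\<close>
  obtain \<phi>0 :: "'a \<Rightarrow> complex" where \<phi>0: "\<phi>0 \<in> gelfand_space"
    using semisimple_eq_0[OF ss, of 1] by auto
  then obtain N where N: "\<phi>0 a = of_int N"
    using int by (auto elim: Ints_cases)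
  \<comment> \<open>The open unit ball around \<open>N\<close> contains no other integer, so one set
    is given both by an open and by a closed condition.\<close>
  define S where "S = {\<phi> \<in> gelfand_space. \<phi> a \<in> ball (of_int N) 1}"
  have S: "S = {\<phi> \<in> gelfand_space. \<phi> a = of_int N}"
  proof -
    have "z = of_int N" if "z \<in> \<int>" "z \<in> ball (of_int N) 1" for z :: complex
    proof -
      obtain M where M: "z = of_int M"
        using \<open>z \<in> \<int>\<close> by (rule Ints_cases)
      have "cmod (of_int (N - M)) < 1"
        using that(2) unfolding M by (simp add: dist_norm)
      then show ?thesis
        unfolding M norm_of_int by (simp add: of_int_abs[symmetric] del: of_int_abs)
    qed
    then show ?thesis
      using int by (auto simp: S_def)
  qed
  have 1: "openin gelfand_topology S"
    unfolding S_def by (rule op) simp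
  have "topspace gelfand_topology - S = {\<phi> \<in> gelfand_space. \<phi> a \<in> - {of_int N}}"
    unfolding S top by auto
  then have "closedin gelfand_topology S"
    unfolding closedin_def using op[of "- {of_int N}"] by (auto simp: S top)
  with 1 conn have "S = {} \<or> S = topspace gelfand_topology"
    by (auto simp: connected_space_clopen_in)
  with \<phi>0 N have eq: "\<phi> a = of_int N" if "\<phi> \<in> gelfand_space" for \<phi>
    using that by (auto simp: S top)
  have "\<phi> (a - of_int N) = 0" if "\<phi> \<in> gelfand_space" for \<phi>
  proof -
    have "of_int N = (scaleC (of_int N) 1 :: 'a)"
      using scaleC_of_real[of "of_int N" "1 :: 'a"] by (simp add: scaleR_conv_of_real)
    then have "\<phi> (of_int N) = of_int N"
      using gelfand_spaceD(2,4)[OF that] by simp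
    then show ?thesis
      using eq[OF that] linear_diff[OF bounded_linear.linear[OF bounded_linear_character[OF that]]] by simp
  qed
  then have "a - of_int N = 0"
    by (rule semisimple_eq_0[OF ss])
  then show thesis
    using that by simp
qed

text \<open>For a fixed character of \<open>'a\<close> the value is a continuous integer-valued
  function of \<open>z\<close>, hence constant because the Euclidean space is connected.
  Semisimplicity then makes \<open>ev k\<close> constant, and the preceding lemma identifies the
  constant.\<close>

lemma Ints_valued_fourier_constant:
  fixes k :: "('e::euclidean_space, 'a::comm_complex_banach_algebra_1) fourier"
  assumes ss: "semisimple TYPE('a)"
    and conn: "connected_space (gelfand_topology :: ('a \<Rightarrow> complex) topology)"
    and int: "\<And>\<phi> z. \<phi> \<in> gelfand_space \<Longrightarrow> \<phi> (ev k z) \<in> \<int>"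
  obtains N :: int where "k = of_int N"
proof -
  have const: "ev k z = ev k 0" for z
  proof -
    have "\<phi> (ev k z - ev k 0) = 0" if \<phi>: "\<phi> \<in> gelfand_space" for \<phi>
    proof -
      have "continuous_on UNIV (\<lambda>z. \<phi> (ev k z))"
        by (intro bounded_linear.continuous_on[OF bounded_linear_character[OF \<phi>]] continuous_on_ev)
      then have "(\<lambda>z. \<phi> (ev k z)) constant_on UNIV"
      proof (rule continuous_discrete_range_constant[OF connected_UNIV])
        show "\<exists>e>0. \<forall>y. y \<in> UNIV \<and> \<phi> (ev k y) \<noteq> \<phi> (ev k x) \<longrightarrow> e \<le> norm (\<phi> (ev k y) - \<phi> (ev k x))" for x
        proof (intro exI[of _ 1] conjI allI impI; clarsimp)
          fix y
          assume ne: "\<phi> (ev k y) \<noteq> \<phi> (ev k x)"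
          obtain M N where M: "\<phi> (ev k y) = of_int M" "\<phi> (ev k x) = of_int N"
            using int[OF \<phi>] by (metis Ints_cases)
          with ne have "1 \<le> \<bar>M - N\<bar>"
            by auto
          then have "1 \<le> \<bar>real_of_int (M - N)\<bar>"
            by linarith
          then show "1 \<le> cmod (\<phi> (ev k y) - \<phi> (ev k x))"
            unfolding M by (metis norm_of_int of_int_diff)
        qed
      qed
      then have "\<phi> (ev k z) = \<phi> (ev k 0)"
        by (auto simp: constant_on_def)
      then show ?thesis
        using linear_diff[OF bounded_linear.linear[OF bounded_linear_character[OF \<phi>]]] by simp
    qed
    then have "ev k z - ev k 0 = 0"
      by (rule semisimple_eq_0[OF ss])
    then show ?thesis
      by simp
  qed
  obtain N where N: "ev k 0 = of_int N"
    by (rule Ints_valued_character_constant[OF ss conn, of "ev k 0"]) (use int in auto)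
  have "ev (of_int N) z = (of_int N :: 'a)" for z :: 'e
  proof -
    have "ev (of_int N *\<^sub>R 1) z = (of_int N *\<^sub>R 1 :: 'a)"
      by (simp only: ev_simps ev_one)
    then show ?thesis
      by (simp add: scaleR_conv_of_real)
  qed
  then have "k = of_int N"
    using const N by (intro ev_inject) auto
  then show thesis
    by (rule that)
qed

section \<open>Units are exponentials up to a monomial\<close>

text \<open>No normalisation is imposed on \<open>c\<close>, which keeps the property stable under
  multiplication by exponentials and monomials. The value at 0 enters only in the final
  theorem.\<close>

definition exp_form :: "('e::euclidean_space, 'a::comm_complex_banach_algebra_1) fourier \<Rightarrow> bool"
  where "exp_form a \<longleftrightarrow> (\<exists>c \<gamma> g. \<forall>z. ev a z = scaleC (cis (\<gamma> \<bullet> z)) (c * exp (ev g z)))"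

lemma exp_form_mult_exp:
  assumes "exp_form a"
  shows "exp_form (a * exp l)"
proof -
  obtain c \<gamma> g where "\<And>z. ev a z = scaleC (cis (\<gamma> \<bullet> z)) (c * exp (ev g z))"
    using assms by (auto simp: exp_form_def)
  then have "ev (a * exp l) z = scaleC (cis (\<gamma> \<bullet> z)) (c * exp (ev (g + l) z))" for z
    using exp_add_commuting[of "ev g z" "ev l z"]
    by (simp add: ev_mult ev_exp ev_simps mult_scaleC_left mult.assoc)
  then show ?thesis
    unfolding exp_form_def by metis
qed

lemma exp_form_mult_single:
  assumes "exp_form a"
  shows "exp_form (single y 1 * a)"
proof -
  obtain c \<gamma> g where "\<And>z. ev a z = scaleC (cis (\<gamma> \<bullet> z)) (c * exp (ev g z))"
    using assms by (auto simp: exp_form_def)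
  then have "ev (single y 1 * a) z = scaleC (cis ((y + \<gamma>) \<bullet> z)) (c * exp (ev g z))" for z
    by (simp add: ev_mult ev_single mult_scaleC_left scaleC_scaleC cis_mult inner_add_left)
  then show ?thesis
    unfolding exp_form_def by metis
qed

text \<open>A truncation close enough to \<open>a\<close>, divided by \<open>a\<close>, is close to
  1 and hence an exponential. Finite support provides a derivative and reduces the frequencies to
  finitely many generators.\<close>

lemma unit_finite_approximation:
  fixes a :: "('e::euclidean_space, 'a::comm_complex_banach_algebra_1) fourier"
  assumes "a dvd 1"
  obtains F l where "finite F" "restrict_coeff F a = a * exp l"
proof -
  obtain b where ab: "a * b = 1"
    using assms by (metis dvd_def)
  have "norm b > 0"
    using ab by (metis mult_zero_right zero_less_norm_iff zero_neq_one)
  then obtain F where F: "finite F" "norm (a - restrict_coeff F a) < 1 / 16 / norm b"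
    using finite_support_approximation[of "1 / 16 / norm b" a] by auto
  have "norm (restrict_coeff F a * b - 1) = norm ((restrict_coeff F a - a) * b)"
    using ab by (simp add: algebra_simps)
  also have "\<dots> \<le> norm (a - restrict_coeff F a) * norm b"
    by (metis norm_mult_ineq norm_minus_commute)
  also have "\<dots> < 1 / 16"
    using F(2) \<open>norm b > 0\<close> by (simp add: field_simps)
  finally obtain l where "exp l = restrict_coeff F a * b"
    by (rule exists_log_near_1)
  then have "restrict_coeff F a = a * exp l"
    using ab by (metis mult.commute mult.left_commute mult_1)
  with F(1) show thesis
    by (rule that)
qed

section \<open>Gradings by an integer degree\<close>

lemma coeff_sum: "coeff (\<Sum>i\<in>I. f i) x = (\<Sum>i\<in>I. coeff (f i) x)"
  by (rule linear_sum[OF bounded_linear.linear[OF bounded_linear_coeff]])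

text \<open>The finitely many homogeneous parts whose degrees occur in a finite approximating set
  \<open>F\<close> sum to an approximation at least as good, and \<open>h\<close> kills each of
  them.\<close>

lemma functional_eq_0_if_graded:
  fixes m :: "'e \<Rightarrow> 'k" and w :: "('e, 'a::real_normed_vector) fourier"
    and h :: "('e, 'a) fourier \<Rightarrow> 'b::real_normed_vector"
  assumes h: "bounded_linear h" and graded: "\<And>k. h (restrict_coeff {x. m x = k} w) = 0"
  shows "h w = 0"
proof -
  obtain K where K: "K > 0" "\<And>a. norm (h a) \<le> norm a * K"
    using bounded_linear.pos_bounded[OF h] by metis
  have "norm (h w) \<le> 0 + e" if "e > 0" for e
  proof -
    obtain F where F: "finite F" "norm (w - restrict_coeff F w) < e / K"
      using finite_support_approximation[of "e / K" w] K \<open>e > 0\<close> by auto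
    define T where "T = {x. m x \<in> m ` F}"
    have "restrict_coeff T w = (\<Sum>k\<in>m ` F. restrict_coeff {x. m x = k} w)"
      using F(1) by (intro fourier_eqI) (simp add: coeff_sum restrict_coeff.rep_eq T_def)
    then have "h (restrict_coeff T w) = 0"
      by (simp add: linear_sum[OF bounded_linear.linear[OF h]] graded)
    then have "norm (h w) = norm (h (w - restrict_coeff T w))"
      by (simp add: linear_diff[OF bounded_linear.linear[OF h]])
    also have "\<dots> \<le> norm (w - restrict_coeff F w) * K"
      using norm_diff_restrict_coeff_mono[of F T w] K
      by (intro order_trans[OF K(2)] mult_right_mono) (auto simp: T_def)
    also have "\<dots> \<le> e"
      using F(2) K(1) by (simp add: field_simps)
    finally show ?thesis
      by simp
  qed
  then have "norm (h w) \<le> 0"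
    by (rule field_le_epsilon)
  then show ?thesis
    by simp
qed

lemma coeff_single_mult:
  fixes a :: "('e::ab_group_add, 'a::{banach, real_normed_algebra}) fourier"
  shows "coeff (single y c * a) x = c * coeff a (x - y)"
proof -
  have "coeff (single y c * a) x = (\<Sum>\<^sub>\<infinity>u\<in>{y}. coeff (single y c) u * coeff a (x - u))"
    unfolding times_fourier.rep_eq by (rule infsum_cong_neutral) (auto simp: single.rep_eq)
  then show ?thesis
    by (simp add: single.rep_eq)
qed

lemma single_mult_single:
  fixes c d :: "'a::comm_complex_banach_algebra_1"
  shows "single x c * single y d = single (x + y :: 'e::euclidean_space) (c * d)"
  by (rule ev_inject)
    (simp add: ev_mult ev_single mult_scaleC_left mult_scaleC_right scaleC_scaleC cis_mult
      inner_add_left add.commute)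

lemma exists_derivation_finite_support:
  fixes a :: "('e, 'a::real_normed_vector) fourier"
  assumes "finite F"
  obtains a' where "is_derivation_of m (restrict_coeff F a) a'"
proof
  show "is_derivation_of m (restrict_coeff F a) (\<Sum>x\<in>F. single x (m x *\<^sub>R coeff a x))"
    using assms by (simp add: is_derivation_of_def coeff_sum single.rep_eq restrict_coeff.rep_eq)
qed

text \<open>Non-zero integers have modulus at least 1, so dividing by the degree never increases a
  norm. In degree 0 the convention \<open>1 / 0 = 0\<close> sets the coefficient to 0.\<close>

lemma exists_antiderivative:
  fixes c :: "('e, 'a::real_normed_vector) fourier" and m :: "'e \<Rightarrow> int"
  obtains g where "\<And>x. coeff g x = (1 / real_of_int (m x)) *\<^sub>R coeff c x"
proof -
  have "\<bar>1 / real_of_int k\<bar> \<le> 1" for k :: int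
    by (cases "k = 0") (auto simp: divide_le_eq)
  then have "norm ((1 / real_of_int (m x)) *\<^sub>R coeff c x) \<le> norm (coeff c x)" for x
    unfolding norm_scaleR by (intro mult_left_le_one_le) auto
  then have "(\<lambda>x. norm ((1 / real_of_int (m x)) *\<^sub>R coeff c x)) summable_on UNIV"
    by (intro Infinite_Sum.abs_summable_on_comparison_test'[OF norm_coeff_summable[of c]])
  then show thesis
    by (intro that[of "Fourier (\<lambda>x. (1 / real_of_int (m x)) *\<^sub>R coeff c x)"])
      (simp add: Fourier_inverse)
qed

text \<open>As \<open>\<kappa>\<close> has degree 0, the homogeneous parts of \<open>w = exp (- g) p\<close> satisfy
  \<open>\<kappa> w\<^sub>k = k w\<^sub>k\<close>. A character cannot vanish on all of them, since \<open>w\<close> is a unit, so its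
  value at \<open>\<kappa>\<close> is one of the integers \<open>k\<close>.\<close>

lemma exp_form_add_generator:
  fixes G :: "'e::euclidean_space set" and a :: "('e, 'a::comm_complex_banach_algebra_1) fourier"
  assumes ss: "semisimple TYPE('a)"
    and conn: "connected_space (gelfand_topology :: ('a \<Rightarrow> complex) topology)"
    and G: "additive_subgroup G"
    and exp_form_G: "\<And>b :: ('e, 'a) fourier. supported G b \<Longrightarrow> b dvd 1 \<Longrightarrow> exp_form b"
    and y: "\<And>k :: int. of_int k *\<^sub>R y \<in> G \<Longrightarrow> k = 0"
    and H: "H = {x. \<exists>k :: int. x - of_int k *\<^sub>R y \<in> G}"
    and a: "supported H a" "a dvd 1"
  shows "exp_form a"
proof -
  \<comment> \<open>On \<open>H\<close> this is the coefficient of \<open>y\<close>, unique because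
    no non-zero integer multiple of \<open>y\<close> lies in \<open>G\<close>. Off \<open>H\<close>
    its value is unspecified but still invariant under shifts by \<open>G\<close>.\<close>
  define mi :: "'e \<Rightarrow> int" where "mi x = (THE k. x - of_int k *\<^sub>R y \<in> G)" for x
  define m where "m x = real_of_int (mi x)" for x
  note G' = additive_subgroupD[OF G]
  have mi_eq: "mi x = k" if "x - of_int k *\<^sub>R y \<in> G" for x k
    unfolding mi_def
  proof (rule the_equality)
    show "x - of_int k *\<^sub>R y \<in> G"
      by (rule that)
    fix j
    assume "x - of_int j *\<^sub>R y \<in> G"
    with that have "of_int (k - j) *\<^sub>R y \<in> G"
      using G'(2)[of "x - of_int j *\<^sub>R y" "x - of_int k *\<^sub>R y"] by (simp add: algebra_simps)
    then show "j = k"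
      using y[of "k - j"] by simp
  qed
  have H_iff: "x - of_int (mi x) *\<^sub>R y \<in> G" if "x \<in> H" for x
  proof -
    from that obtain k :: int where "x - of_int k *\<^sub>R y \<in> G"
      unfolding H by blast
    then show ?thesis
      using mi_eq by simp
  qed
  have H_sub: "additive_subgroup H"
    unfolding H by (rule additive_subgroup_add_generator[OF G])
  have m_add: "m (x + u) = m x + m u" if "x \<in> H" "u \<in> H" for x u
  proof -
    have "mi (x + u) = mi x + mi u"
      using G'(4)[OF H_iff[OF that(1)] H_iff[OF that(2)]] by (intro mi_eq) (simp add: algebra_simps)
    then show ?thesis
      by (simp add: m_def)
  qed
  have m_shift: "mi (x - u) = mi x" if "u \<in> G" for x u
  proof -
    have "x - u - of_int k *\<^sub>R y \<in> G \<longleftrightarrow> x - of_int k *\<^sub>R y \<in> G" for k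
      using G'(5)[OF that, of "x - of_int k *\<^sub>R y"] by (simp add: algebra_simps)
    then show ?thesis
      by (simp add: mi_def)
  qed
  have G_iff: "x \<in> G \<longleftrightarrow> mi x = 0" if "x \<in> H" for x
    using H_iff[OF that] mi_eq[of x 0] by auto

  \<comment> \<open>The unit \<open>a\<close> is traded for a finitely supported unit
    \<open>p\<close>, which has a derivative \<open>p'\<close>.\<close>
  obtain F l where F: "finite F" and p_eq: "restrict_coeff F a = a * exp l"
    by (rule unit_finite_approximation[OF a(2)])
  define p where "p = restrict_coeff F a"
  have p_H: "supported H p"
    using a(1) by (auto simp: p_def supported_def restrict_coeff.rep_eq)
  obtain b where b: "a * b = 1"
    using a(2) by (metis dvd_def)
  define q where "q = b * exp (- l)"
  have "p * q = (a * b) * (exp l * exp (- l))"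
    by (simp add: p_def q_def p_eq mult_ac)
  then have pq: "p * q = 1"
    by (simp add: b exp_minus_inverse)
  have q_H: "supported H q"
    by (rule supported_inverse[OF H_sub p_H pq])
  obtain p' where p': "is_derivation_of m p p'"
    unfolding p_def by (rule exists_derivation_finite_support[OF F])
  then have p'_H: "supported H p'"
    using p_H by (auto simp: supported_def is_derivation_of_def)

  \<comment> \<open>Here \<open>c\<close> is the logarithmic derivative of \<open>p\<close>,
    \<open>\<kappa>\<close> its part of degree 0, and \<open>g\<close> an antiderivative of the
    remainder \<open>c - \<kappa>\<close>.\<close>
  define c where "c = p' * q"
  have c_H: "supported H c"
    unfolding c_def by (rule supported_mult[OF H_sub p'_H q_H])
  have cp: "c * p = p'"
    using pq by (simp add: c_def mult_ac)
  define \<kappa> where "\<kappa> = restrict_coeff G c"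
  obtain g where g: "\<And>x. coeff g x = (1 / m x) *\<^sub>R coeff c x"
    using exists_antiderivative[of mi c] unfolding m_def by metis
  have g_H: "supported H (- g)"
    using c_H by (simp add: supported_def coeff_simps g)
  have dg: "is_derivation_of m (- g) (- (c - \<kappa>))"
    unfolding is_derivation_of_def
  proof
    fix x
    show "coeff (- (c - \<kappa>)) x = m x *\<^sub>R coeff (- g) x"
      using c_H G_iff[of x] by (cases "x \<in> H")
        (auto simp: coeff_simps g \<kappa>_def restrict_coeff.rep_eq supported_def m_def)
  qed
  \<comment> \<open>The factor \<open>exp (- g)\<close> contributes \<open>- (c - \<kappa>)\<close>
    to the logarithmic derivative and \<open>p\<close> contributes \<open>c\<close>, so that only
    \<open>\<kappa>\<close> is left for \<open>w\<close>.\<close>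
  define w where "w = exp (- g) * p"
  have w_H: "supported H w"
    unfolding w_def by (intro supported_mult supported_exp H_sub g_H p_H)
  have "is_derivation_of m w (exp (- g) * (- (c - \<kappa>)) * p + exp (- g) * p')"
    unfolding w_def
    by (rule derivation_mult[OF m_add supported_exp[OF H_sub g_H] p_H
          derivation_exp[OF H_sub m_add g_H dg] p'])
  also have "exp (- g) * (- (c - \<kappa>)) * p + exp (- g) * p' = \<kappa> * w"
    unfolding w_def cp[symmetric] by (simp add: algebra_simps)
  finally have dw: "is_derivation_of m w (\<kappa> * w)" .

  define W where "W k = restrict_coeff {x. mi x = k} w" for k
  have W: "\<kappa> * W k = of_int k *\<^sub>R W k" for k
  proof -
    \<comment> \<open>Multiplication by \<open>\<kappa>\<close> preserves degrees, since its support
      lies in \<open>G\<close>; so the differential equation for \<open>w\<close> holds in each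
      degree separately.\<close>
    have "\<kappa> * W k = restrict_coeff {x. mi x = k} (\<kappa> * w)"
      unfolding W_def
      by (rule restrict_coeff_mult[symmetric, of G]) (auto simp: \<kappa>_def supported_simple m_shift)
    also have "\<dots> = of_int k *\<^sub>R W k"
      using dw by (intro fourier_eqI)
        (simp add: restrict_coeff.rep_eq coeff_simps W_def is_derivation_of_def m_def)
    finally show ?thesis .
  qed
  have w_unit: "w * (exp g * q) = 1"
  proof -
    have "w * (exp g * q) = (p * q) * (exp g * exp (- g))"
      by (simp add: w_def mult_ac)
    then show ?thesis
      by (simp add: pq exp_minus_inverse)
  qed
  have "\<phi> (ev \<kappa> z) \<in> \<int>" if \<phi>: "\<phi> \<in> gelfand_space" for \<phi> z
  proof (rule ccontr)
    assume nonint: "\<phi> (ev \<kappa> z) \<notin> \<int>"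
    have lin: "bounded_linear (\<lambda>b. \<phi> (ev b z))"
      by (rule bounded_linear_compose[OF bounded_linear_character[OF \<phi>] bounded_linear_ev])
    have "\<phi> (ev (W k) z) = 0" for k
    proof -
      have "\<phi> (ev \<kappa> z) * \<phi> (ev (W k) z) = \<phi> (ev (\<kappa> * W k) z)"
        by (simp only: ev_mult gelfand_spaceD(3)[OF \<phi>])
      also have "\<dots> = of_int k *\<^sub>R \<phi> (ev (W k) z)"
        unfolding W by (rule linear_cmul[OF bounded_linear.linear[OF lin]])
      finally have "\<phi> (ev \<kappa> z) * \<phi> (ev (W k) z) = of_int k * \<phi> (ev (W k) z)"
        by (simp add: scaleR_conv_of_real)
      with nonint show ?thesis
        by auto
    qed
    then have "\<phi> (ev w z) = 0"
      unfolding W_def by (rule functional_eq_0_if_graded[OF lin])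
    moreover have "\<phi> (ev w z) * \<phi> (ev (exp g * q) z) = 1"
      using arg_cong[OF w_unit, of "\<lambda>b. \<phi> (ev b z)"]
      by (simp add: ev_mult[of w] ev_one gelfand_spaceD[OF \<phi>])
    ultimately show False
      by simp
  qed
  then obtain N where N: "\<kappa> = of_int N"
    by (rule Ints_valued_fourier_constant[OF ss conn])

  \<comment> \<open>With \<open>\<kappa> = N\<close> the equations for the homogeneous parts
    annihilate all but the one of degree \<open>N\<close>. Shifting frequencies by
    \<open>- N y\<close> therefore moves \<open>w\<close> into the algebra over
    \<open>G\<close>.\<close>
  define u where "u = single (- (of_int N *\<^sub>R y)) 1 * w"
  have W0: "W k = 0" if "k \<noteq> N" for k
  proof -
    have "of_int N = (of_real (of_int N) :: ('e, 'a) fourier)"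
      by simp
    then have "of_int N *\<^sub>R W k = of_int k *\<^sub>R W k"
      using W[of k] unfolding N scaleR_conv_of_real by metis
    with that show ?thesis
      by simp
  qed
  have w_N: "mi x = N" if "coeff w x \<noteq> 0" for x
  proof (rule ccontr)
    assume "mi x \<noteq> N"
    then have "coeff (W (mi x)) x = 0"
      using W0 by (simp add: coeff_simps)
    with that show False
      by (simp add: W_def restrict_coeff.rep_eq)
  qed
  have u_G: "supported G u"
    unfolding supported_def
  proof (intro allI impI)
    fix x
    assume x: "x \<notin> G"
    show "coeff u x = 0"
    proof (rule ccontr)
      assume "coeff u x \<noteq> 0"
      then have "coeff w (x + of_int N *\<^sub>R y) \<noteq> 0"
        by (simp add: u_def coeff_single_mult)
      then have "mi (x + of_int N *\<^sub>R y) = N" "x + of_int N *\<^sub>R y \<in> H"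
        using w_N w_H by (auto simp: supported_def)
      then show False
        using H_iff[of "x + of_int N *\<^sub>R y"] x by simp
    qed
  qed
  have w_eq: "w = single (of_int N *\<^sub>R y) 1 * u"
    by (simp add: u_def mult.assoc[symmetric] single_mult_single one_fourier_def[symmetric])
  have "u * (single (of_int N *\<^sub>R y) 1 * (exp g * q)) = w * (exp g * q)"
    by (simp add: w_eq mult_ac)
  then have "u dvd 1"
    unfolding w_unit by (metis dvd_triv_left)
  then have "exp_form w"
    unfolding w_eq by (intro exp_form_mult_single exp_form_G u_G)
  \<comment> \<open>The factors \<open>exp (- g)\<close> and \<open>exp l\<close>, introduced by
    integration and truncation, are cancelled again.\<close>
  then have "exp_form (w * exp g * exp (- l))"
    by (intro exp_form_mult_exp)
  also have "w * exp g * exp (- l) = a * (exp l * exp (- l)) * (exp g * exp (- g))"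
    by (simp add: w_def p_def p_eq mult_ac)
  finally show ?thesis
    by (simp add: exp_minus_inverse)
qed

section \<open>Dilations and the induction over generators\<close>

lemma exists_dilation:
  fixes a :: "('e::euclidean_space, 'a::comm_complex_banach_algebra_1) fourier"
  assumes "r \<noteq> 0"
  obtains d where "\<And>x. coeff d x = coeff a ((1 / r) *\<^sub>R x)" "\<And>z. ev d z = ev a (r *\<^sub>R z)"
proof -
  have bij: "bij_betw (\<lambda>x. (1 / r) *\<^sub>R x) (UNIV :: 'e set) UNIV"
    using assms by (intro bij_betwI[of _ _ _ "\<lambda>x. r *\<^sub>R x"]) auto
  define d where "d = Fourier (\<lambda>x. coeff a ((1 / r) *\<^sub>R x))"
  have "(\<lambda>x. norm (coeff a ((1 / r) *\<^sub>R x))) summable_on UNIV"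
    using summable_on_reindex_bij_betw[OF bij, of "\<lambda>x. norm (coeff a x)"] norm_coeff_summable[of a]
    by simp
  then have c: "coeff d x = coeff a ((1 / r) *\<^sub>R x)" for x
    by (simp add: d_def Fourier_inverse)
  have "ev d z = ev a (r *\<^sub>R z)" for z
    using infsum_reindex_bij_betw[OF bij, of "\<lambda>x. scaleC (cis (x \<bullet> r *\<^sub>R z)) (coeff a x)"] assms
    by (simp add: ev_def c)
  with c show thesis
    by (rule that)
qed

text \<open>The substitution \<open>z -> r z\<close> multiplies frequencies by \<open>r\<close>,
  carrying units over the rescaled group to units over \<open>G\<close>. The inverse substitution
  brings the exponential form back, replacing \<open>\<gamma>\<close> by
  \<open>\<gamma> / r\<close>.\<close>

lemma exp_form_dilate:
  fixes a :: "('e::euclidean_space, 'a::comm_complex_banach_algebra_1) fourier"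
  assumes "r \<noteq> 0"
    and exp_form_G: "\<And>b :: ('e, 'a) fourier. supported G b \<Longrightarrow> b dvd 1 \<Longrightarrow> exp_form b"
    and a: "supported {x. r *\<^sub>R x \<in> G} a" "a dvd 1"
  shows "exp_form a"
proof -
  obtain b where b: "a * b = 1"
    using a(2) by (metis dvd_def)
  obtain d where d: "\<And>x. coeff d x = coeff a ((1 / r) *\<^sub>R x)" "\<And>z. ev d z = ev a (r *\<^sub>R z)"
    using exists_dilation[OF assms(1)] by metis
  obtain e where e: "\<And>z. ev e z = ev b (r *\<^sub>R z)"
    using exists_dilation[OF assms(1)] by metis
  have "supported G d"
    using a(1) assms(1) by (auto simp: supported_def d)
  moreover have "ev a z * ev b z = 1" for z
    by (metis b ev_mult ev_one)
  then have "d * e = 1"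
    by (intro ev_inject) (simp add: ev_mult d e ev_one)
  then have "d dvd 1"
    by (metis dvd_triv_left)
  ultimately obtain c \<gamma> g where f: "\<And>z. ev d z = scaleC (cis (\<gamma> \<bullet> z)) (c * exp (ev g z))"
    using exp_form_G unfolding exp_form_def by blast
  have "1 / r \<noteq> 0"
    using assms(1) by simp
  then obtain h where h: "\<And>z. ev h z = ev g ((1 / r) *\<^sub>R z)"
    using exists_dilation by metis
  have "ev a z = scaleC (cis (((1 / r) *\<^sub>R \<gamma>) \<bullet> z)) (c * exp (ev h z))" for z
    using f[of "(1 / r) *\<^sub>R z"] d(2)[of "(1 / r) *\<^sub>R z"] assms(1) by (simp add: h)
  then show ?thesis
    unfolding exp_form_def by metis
qed

text \<open>Induction over the generators in \<open>S\<close>. Asking only for some subgroup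
  containing \<open>S\<close>, rather than the generated one, leaves room for rescaling at a
  dependent generator.\<close>

lemma exists_subgroup_exp_form:
  fixes S :: "'e::euclidean_space set"
  assumes ss: "semisimple TYPE('a::comm_complex_banach_algebra_1)"
    and conn: "connected_space (gelfand_topology :: ('a \<Rightarrow> complex) topology)"
    and "finite S"
  shows "\<exists>G. additive_subgroup G \<and> S \<subseteq> G \<and>
    (\<forall>a :: ('e, 'a) fourier. supported G a \<longrightarrow> a dvd 1 \<longrightarrow> exp_form a)"
  using \<open>finite S\<close>
proof (induction S)
  case empty
  have "exp_form a" if "supported {0} a" for a :: "('e, 'a) fourier"
  proof -
    have "a = single 0 (coeff a 0)"
      using that by (intro fourier_eqI) (auto simp: single.rep_eq supported_def)
    then have "ev a z = coeff a 0" for z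
      using ev_single[of 0 "coeff a 0" z] by simp
    then have "ev a z = scaleC (cis (0 \<bullet> z)) (coeff a 0 * exp (ev 0 z))" for z
      by (simp add: ev_simps)
    then show ?thesis
      unfolding exp_form_def by metis
  qed
  then show ?case
    by (intro exI[of _ "{0}"]) (auto simp: additive_subgroup_def)
next
  case (insert s S)
  then obtain G where G: "additive_subgroup G" "S \<subseteq> G"
    and exp_form_G: "\<And>a :: ('e, 'a) fourier. supported G a \<Longrightarrow> a dvd 1 \<Longrightarrow> exp_form a"
    by auto
  note G' = additive_subgroupD[OF G(1)]
  have of_nat_mem: "of_nat n *\<^sub>R x \<in> G" if "x \<in> G" for x n
    by (induction n) (auto simp: G' that scaleR_left_distrib)
  have of_int_mem: "of_int k *\<^sub>R x \<in> G" if "x \<in> G" for x k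
    using of_nat_mem[OF that] G'(3)[OF of_nat_mem[OF that]] by (cases k rule: int_cases2) auto
  show ?case
  proof (cases "\<forall>k :: int. of_int k *\<^sub>R s \<in> G \<longrightarrow> k = 0")
    case True
    define H where "H = {x. \<exists>k :: int. x - of_int k *\<^sub>R s \<in> G}"
    have "additive_subgroup H"
      unfolding H_def by (rule additive_subgroup_add_generator[OF G(1)])
    moreover have "insert s S \<subseteq> H"
    proof -
      have "s - of_int 1 *\<^sub>R s \<in> G" "\<And>x. x \<in> S \<Longrightarrow> x - of_int 0 *\<^sub>R s \<in> G"
        using G' G(2) by auto
      then show ?thesis
        unfolding H_def by blast
    qed
    moreover have "exp_form a" if "supported H a" "a dvd 1" for a :: "('e, 'a) fourier"
      by (rule exp_form_add_generator[OF ss conn G(1) exp_form_G _ H_def that]) (use True in auto)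
    ultimately show ?thesis
      by blast
  next
    case False
    then obtain k :: int where k: "of_int k *\<^sub>R s \<in> G" "k \<noteq> 0"
      by auto
    \<comment> \<open>This is \<open>G\<close> scaled by \<open>1 / k\<close>. It contains
      \<open>s\<close> by the choice of \<open>k\<close>, and \<open>S\<close> because
      \<open>G\<close> is closed under integer multiples.\<close>
    define H where "H = {x. of_int k *\<^sub>R x \<in> G}"
    have "additive_subgroup H"
      using G' by (auto simp: additive_subgroup_def H_def scaleR_right_diff_distrib)
    moreover have "insert s S \<subseteq> H"
      using k G(2) of_int_mem by (auto simp: H_def)
    moreover have "exp_form a" if "supported H a" "a dvd 1" for a :: "('e, 'a) fourier"
      by (rule exp_form_dilate[OF _ exp_form_G that(1)[unfolded H_def] that(2)]) (use k in auto)
    ultimately show ?thesis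
      by blast
  qed
qed

text \<open>Truncation changes the unit by an exponential factor only, so the result for finitely
  many generators applies and the factor is divided out afterwards.\<close>

lemma exp_form_unit:
  fixes a :: "('e::euclidean_space, 'a::comm_complex_banach_algebra_1) fourier"
  assumes ss: "semisimple TYPE('a)"
    and conn: "connected_space (gelfand_topology :: ('a \<Rightarrow> complex) topology)"
    and a: "a dvd 1"
  shows "exp_form a"
proof -
  obtain F l where F: "finite F" and p: "restrict_coeff F a = a * exp l"
    by (rule unit_finite_approximation[OF a])
  obtain G where G: "F \<subseteq> G" "\<forall>b :: ('e, 'a) fourier. supported G b \<longrightarrow> b dvd 1 \<longrightarrow> exp_form b"
    using exists_subgroup_exp_form[OF ss conn F] by auto
  have "exp l dvd 1"
    using dvd_triv_left[of "exp l" "exp (- l)"] by (simp add: exp_minus_inverse)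
  with a have "a * exp l dvd 1"
    using mult_dvd_mono[of a 1 "exp l" 1] by simp
  moreover have "supported G (a * exp l)"
    unfolding p[symmetric] using G(1) by (auto simp: supported_def restrict_coeff.rep_eq)
  ultimately have "exp_form (a * exp l * exp (- l))"
    using G(2) by (intro exp_form_mult_exp[of "a * exp l"]) simp
  then show ?thesis
    by (simp add: mult.assoc exp_minus_inverse)
qed

section \<open>Translation to functions and the equivalence\<close>

lemma GFS_eq_range_ev:
  "(GFS :: (real ^ 'n \<Rightarrow> 'a::comm_complex_banach_algebra_1) set) = range ev"
proof (intro equalityI subsetI)
  fix f :: "real ^ 'n \<Rightarrow> 'a"
  assume "f \<in> GFS"
  then obtain B a where B: "(\<lambda>x. norm (a x)) summable_on B"
    and f: "\<And>z. f z = (\<Sum>\<^sub>\<infinity>x\<in>B. scaleC (cis (x \<bullet> z)) (a x))"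
    unfolding GFS_def cis_conv_exp by blast
  \<comment> \<open>Extension by zero off \<open>B\<close> replaces the family on a countable set by
    one on the whole space with the same sums.\<close>
  define b where "b x = (if x \<in> B then a x else 0)" for x
  have "(\<lambda>x. norm (b x)) summable_on UNIV \<longleftrightarrow> (\<lambda>x. norm (a x)) summable_on B"
    by (rule summable_on_cong_neutral) (auto simp: b_def)
  with B have "(\<lambda>x. norm (b x)) summable_on UNIV"
    by simp
  then have b: "coeff (Fourier b) = b"
    by (simp add: Fourier_inverse)
  have "f z = ev (Fourier b) z" for z
    unfolding f ev_def b by (rule infsum_cong_neutral) (auto simp: b_def)
  then show "f \<in> range ev"
    by auto
next
  fix f :: "real ^ 'n \<Rightarrow> 'a"
  assume "f \<in> range ev"
  then obtain a where f: "f = ev a"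
    by auto
  define B where "B = {x. coeff a x \<noteq> 0}"
  have "countable B"
    using abs_summable_countable[OF norm_coeff_summable[of a UNIV]] by (simp add: B_def)
  moreover have "f z = (\<Sum>\<^sub>\<infinity>x\<in>B. scaleC (exp (\<i> * complex_of_real (x \<bullet> z))) (coeff a x))" for z
    unfolding f ev_def cis_conv_exp by (rule infsum_cong_neutral) (auto simp: B_def)
  ultimately show "f \<in> GFS"
    unfolding GFS_def using norm_coeff_summable[of a B] by blast
qed

text \<open>The map from \<open>c\<close> to \<open>scaleC c 1\<close> is a bounded unital
  homomorphism, so it commutes with the exponential. This links the linear exponent of the theorem
  to monomials.\<close>

lemma exp_scaleC_1_plus:
  fixes x :: "'a::comm_complex_banach_algebra_1"
  shows "exp (scaleC (\<i> * complex_of_real t) 1 + x) = scaleC (cis t) (exp x)"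
proof -
  have "exp (scaleC (\<i> * complex_of_real t) 1 :: 'a) = scaleC (cis t) 1"
    unfolding cis_conv_exp
    by (rule exp_homomorphism[OF bounded_linear_scaleC_left, symmetric])
      (simp_all add: mult_scaleC_left scaleC_scaleC)
  then show ?thesis
    by (subst exp_add_commuting) (simp_all add: mult_scaleC_left mult_scaleC_right)
qed

theorem theorem7p9:
  fixes f :: "real ^ 'n \<Rightarrow> 'a::comm_complex_banach_algebra_1"
  assumes "semisimple TYPE('a)"
    and "connected_space (gelfand_topology :: ('a \<Rightarrow> complex) topology)"
    and "f \<in> GFS"
  shows "(GFS_invertible f \<longleftrightarrow>
      f 0 dvd 1 \<and> (\<exists>\<gamma> :: real ^ 'n. \<exists>g1 \<in> GFS. \<forall>z.
        f z = f 0 * exp (scaleC (\<i> * complex_of_real (\<gamma> \<bullet> z)) 1 + g1 z)))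
    \<and> (GFS_invertible f \<longleftrightarrow>
      f 0 dvd 1 \<and> (\<exists>\<gamma> :: real ^ 'n. \<exists>g2 \<in> GFS. \<forall>z.
        f z = f 0 * exp (scaleC (\<i> * complex_of_real (\<gamma> \<bullet> z)) 1 + g2 z - g2 0)))"
    (is "(?i \<longleftrightarrow> ?vii) \<and> (?i \<longleftrightarrow> ?viii)")
proof -
  \<comment> \<open>The implications form a cycle from (i) to (viii), then to (vii), and back to
    (i).\<close>
  have "?viii" if ?i
  proof -
    obtain h where h: "h \<in> GFS" "\<And>z. f z * h z = 1"
      using \<open>?i\<close> unfolding GFS_invertible_def by metis
    obtain a b where ab: "f = ev a" "h = ev b"
      using h(1) assms(3) by (auto simp: GFS_eq_range_ev)
    have "a * b = 1"
      by (rule ev_inject) (use h(2) in \<open>simp add: ab ev_mult ev_one\<close>)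
    then have "exp_form a"
      using exp_form_unit[OF assms(1,2)] by (metis dvd_triv_left)
    then obtain c \<gamma> g where g: "\<And>z. f z = scaleC (cis (\<gamma> \<bullet> z)) (c * exp (ev g z))"
      unfolding exp_form_def ab by blast
    have "f z = f 0 * exp (scaleC (\<i> * complex_of_real (\<gamma> \<bullet> z)) 1 + ev g z - ev g 0)" for z
    proof -
      \<comment> \<open>Splitting off the value of the exponential at 0 completes the constant
        \<open>c\<close> to \<open>f 0\<close>.\<close>
      have "exp (ev g z) = exp (ev g 0) * exp (ev g z - ev g 0)"
        using exp_add_commuting[of "ev g 0" "ev g z - ev g 0"] by (simp add: mult.commute)
      then show ?thesis
        using g[of 0] g[of z] exp_scaleC_1_plus[of "\<gamma> \<bullet> z" "ev g z - ev g 0"]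
        by (simp add: mult_scaleC_right mult.assoc add_diff_eq)
    qed
    moreover have "f 0 dvd 1"
      using h(2)[of 0] by (metis dvd_triv_left)
    ultimately show ?viii
      unfolding GFS_eq_range_ev by blast
  qed
  moreover have "?vii" if ?viii
  proof -
    obtain \<gamma> :: "real ^ 'n" and a where "f 0 dvd 1"
      and f: "\<And>z. f z = f 0 * exp (scaleC (\<i> * complex_of_real (\<gamma> \<bullet> z)) 1 + ev a z - ev a 0)"
      using \<open>?viii\<close> unfolding GFS_eq_range_ev by blast
    \<comment> \<open>The constant \<open>ev a 0\<close> is the monomial of frequency 0, so
      subtracting it stays inside \<open>GFS\<close>.\<close>
    moreover have "ev (a - single 0 (ev a 0)) z = ev a z - ev a 0" for z
      by (simp add: ev_simps ev_single)
    ultimately have "\<forall>z. f z = f 0 * exp (scaleC (\<i> * complex_of_real (\<gamma> \<bullet> z)) 1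
        + ev (a - single 0 (ev a 0)) z)"
      by (metis add_diff_eq)
    with \<open>f 0 dvd 1\<close> show ?vii
      unfolding GFS_eq_range_ev by blast
  qed
  moreover have "?i" if ?vii
  proof -
    obtain \<gamma> :: "real ^ 'n" and a b where b: "1 = f 0 * b"
      and f: "\<And>z. f z = f 0 * exp (scaleC (\<i> * complex_of_real (\<gamma> \<bullet> z)) 1 + ev a z)"
      using \<open>?vii\<close> unfolding GFS_eq_range_ev dvd_def by blast
    \<comment> \<open>Each of the three factors is inverted separately: \<open>f 0\<close> by
      \<open>b\<close>, the monomial by the opposite frequency, and the exponential by that of
      \<open>- a\<close>.\<close>
    define h where "h = single (- \<gamma>) b * exp (- a)"
    have "f z * ev h z = 1" for z
    proof -
      have "f z * ev h z = (f 0 * b) * (exp (ev a z) * exp (- ev a z))"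
        unfolding f[of z] exp_scaleC_1_plus h_def
        by (simp add: ev_mult ev_single ev_exp ev_simps mult_scaleC_left mult_scaleC_right
            scaleC_scaleC cis_mult mult_ac)
      then show ?thesis
        by (simp add: b[symmetric] exp_minus_inverse)
    qed
    then show ?i
      using assms(3) unfolding GFS_invertible_def GFS_eq_range_ev by blast
  qed
  ultimately show ?thesis
    by blast
qed

end
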